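(* Let $E$ be an arbitrary directed graph, $K$ a field, and $L=L_K(E)$ the Leavitt path algebra of $E$ over $K$. The following are equivalent: (i) every proper two-sided ideal $I$ of $L$ is the intersection of all the primitive ideals of $L$ containing $I$; (ii) every proper two-sided ideal $I$ of $L$ is the intersection of all the prime ideals of $L$ containing $I$; (iii) the graph $E$ satisfies Condition (K).
   Context: A directed graph $E=(E^0,E^1,r,s)$ consists of sets $E^0$ (vertices) and $E^1$ (edges), of arbitrary cardinality, with maps $r,s:E^1\to E^0$ (range, source). A vertex $v$ is regular if $s^{-1}(v)$ is finite and non-empty. The Leavitt path algebra $L_K(E)$ is the (not necessarily unital) $K$-algebra generated by pairwise orthogonal idempotents $\{v:v\in E^0\}$ and elements $\{e,e^*:e\in E^1\}$ subject to: (1) $s(e)e=e=er(e)$; (2) $r(e)e^*=e^*=e^*s(e)$; (3) $e^*e=r(e)$ and $e^*f=0$ for edges $e\ne f$; (4) $v=\sum_{s(e)=v}ee^*$ for every regular vertex $v$. A path of positive length is $\mu=e_1\cdots e_n$ with $r(e_i)=s(e_{i+1})$; it is closed, based at $s(e_1)$, if $r(e_n)=s(e_1)$; a closed path is simple if $s(e_i)\ne s(e_1)$ for all $i\ge2$. $E$ satisfies Condition (K) if every vertex that is the base of a simple closed path $c$ is also the base of a simple closed path $c'\neq c$. Ideals are two-sided. A proper ideal $P$ is prime if for all two-sided ideals $A,B$, $AB\subseteq P$ implies $A\subseteq P$ or $B\subseteq P$. A primitive ideal is the annihilator of a simple (left) module. *)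

theory Defs
  imports "HOL-Algebra.Module" "HOL-Algebra.Ideal_Product" "Graph_Theory.Arc_Walk"
begin

section \<open>Rings without identity, ideals and primitive ideals\<close>

text \<open>Leavitt path algebras need not be unital. The records of HOL-Algebra are reused for
  non-unital rings; the field \<open>one\<close> is never referred to.\<close>

locale rng = abelian_group R for R (structure) +
  assumes rng_m_closed: "\<lbrakk>x \<in> carrier R; y \<in> carrier R\<rbrakk> \<Longrightarrow> x \<otimes> y \<in> carrier R"
    and rng_m_assoc: "\<lbrakk>x \<in> carrier R; y \<in> carrier R; z \<in> carrier R\<rbrakk> \<Longrightarrow>
      (x \<otimes> y) \<otimes> z = x \<otimes> (y \<otimes> z)"
    and rng_l_distr: "\<lbrakk>x \<in> carrier R; y \<in> carrier R; z \<in> carrier R\<rbrakk> \<Longrightarrow>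
      (x \<oplus> y) \<otimes> z = x \<otimes> z \<oplus> y \<otimes> z"
    and rng_r_distr: "\<lbrakk>x \<in> carrier R; y \<in> carrier R; z \<in> carrier R\<rbrakk> \<Longrightarrow>
      z \<otimes> (x \<oplus> y) = z \<otimes> x \<oplus> z \<otimes> y"

locale rng_ideal = additive_subgroup I R + rng R for I and R (structure) +
  assumes rng_I_l_closed: "\<lbrakk>a \<in> I; x \<in> carrier R\<rbrakk> \<Longrightarrow> x \<otimes> a \<in> I"
    and rng_I_r_closed: "\<lbrakk>a \<in> I; x \<in> carrier R\<rbrakk> \<Longrightarrow> a \<otimes> x \<in> I"

definition proper_rng_ideal :: "'a set \<Rightarrow> ('a, 'b) ring_scheme \<Rightarrow> bool" where
  "proper_rng_ideal I R \<longleftrightarrow> rng_ideal I R \<and> I \<noteq> carrier R"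

definition prime_rng_ideal :: "'a set \<Rightarrow> ('a, 'b) ring_scheme \<Rightarrow> bool" where
  "prime_rng_ideal P R \<longleftrightarrow> proper_rng_ideal P R \<and>
     (\<forall>A B. rng_ideal A R \<longrightarrow> rng_ideal B R \<longrightarrow> A \<cdot>\<^bsub>R\<^esub> B \<subseteq> P \<longrightarrow> A \<subseteq> P \<or> B \<subseteq> P)"

locale rng_left_module = R?: rng R + M?: abelian_group M
  for R :: "('a, 'b) ring_scheme" (structure) and M :: "('a, 'm, 'c) module_scheme" (structure) +
  assumes lm_smult_closed:
      "\<lbrakk>a \<in> carrier R; x \<in> carrier M\<rbrakk> \<Longrightarrow> a \<odot>\<^bsub>M\<^esub> x \<in> carrier M"
    and lm_smult_l_distr: "\<lbrakk>a \<in> carrier R; b \<in> carrier R; x \<in> carrier M\<rbrakk> \<Longrightarrow>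
      (a \<oplus>\<^bsub>R\<^esub> b) \<odot>\<^bsub>M\<^esub> x = a \<odot>\<^bsub>M\<^esub> x \<oplus>\<^bsub>M\<^esub> b \<odot>\<^bsub>M\<^esub> x"
    and lm_smult_r_distr: "\<lbrakk>a \<in> carrier R; x \<in> carrier M; y \<in> carrier M\<rbrakk> \<Longrightarrow>
      a \<odot>\<^bsub>M\<^esub> (x \<oplus>\<^bsub>M\<^esub> y) = a \<odot>\<^bsub>M\<^esub> x \<oplus>\<^bsub>M\<^esub> a \<odot>\<^bsub>M\<^esub> y"
    and lm_smult_assoc: "\<lbrakk>a \<in> carrier R; b \<in> carrier R; x \<in> carrier M\<rbrakk> \<Longrightarrow>
      (a \<otimes>\<^bsub>R\<^esub> b) \<odot>\<^bsub>M\<^esub> x = a \<odot>\<^bsub>M\<^esub> (b \<odot>\<^bsub>M\<^esub> x)"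

text \<open>In the absence of an identity, a simple module is required to satisfy \<open>R M \<noteq> 0\<close>
  (in particular \<open>M \<noteq> 0\<close>), which replaces unitality.\<close>

definition simple_left_module :: "('a, 'b) ring_scheme \<Rightarrow> ('a, 'm, 'c) module_scheme \<Rightarrow> bool" where
  "simple_left_module R M \<longleftrightarrow> rng_left_module R M \<and>
     (\<exists>r\<in>carrier R. \<exists>x\<in>carrier M. r \<odot>\<^bsub>M\<^esub> x \<noteq> \<zero>\<^bsub>M\<^esub>) \<and>
     (\<forall>N. submodule N R M \<longrightarrow> N = {\<zero>\<^bsub>M\<^esub>} \<or> N = carrier M)"

definition left_annihilator :: "('a, 'b) ring_scheme \<Rightarrow> ('a, 'm, 'c) module_scheme \<Rightarrow> 'a set" where
  "left_annihilator R M = {r \<in> carrier R. \<forall>x\<in>carrier M. r \<odot>\<^bsub>M\<^esub> x = \<zero>\<^bsub>M\<^esub>}"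

text \<open>The existential quantifier has to fix a type for the elements of the module. A simple
  module is isomorphic to a quotient of \<open>R\<close> by a left ideal, whose elements are subsets of
  \<open>R\<close>, so the type \<open>'a set\<close> is general enough; see \<open>primitive_rng_idealI\<close> below.\<close>

definition primitive_rng_ideal :: "'a set \<Rightarrow> ('a, 'b) ring_scheme \<Rightarrow> bool" where
  "primitive_rng_ideal P R \<longleftrightarrow>
     (\<exists>M :: ('a, 'a set) module. simple_left_module R M \<and> P = left_annihilator R M)"


section \<open>Algebras given by generators and relations\<close>

datatype (gens: 'x, dead 'k) alg_term =
    Gen 'x
  | Zero
  | Add "('x, 'k) alg_term" "('x, 'k) alg_term"
  | Scale 'k "('x, 'k) alg_term"
  | Mult "('x, 'k) alg_term" "('x, 'k) alg_term"

text \<open>The congruence generated by a set of relations and the axioms of associative, not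
  necessarily unital algebras over the field \<open>'k\<close>.\<close>

inductive alg_cong :: "('x, 'k::field) alg_term rel \<Rightarrow> ('x, 'k) alg_term \<Rightarrow> ('x, 'k) alg_term \<Rightarrow> bool"
  for Rel where
  rel: "(s, t) \<in> Rel \<Longrightarrow> alg_cong Rel s t"
| refl: "alg_cong Rel t t"
| sym: "alg_cong Rel s t \<Longrightarrow> alg_cong Rel t s"
| trans: "alg_cong Rel s t \<Longrightarrow> alg_cong Rel t u \<Longrightarrow> alg_cong Rel s u"
| add: "alg_cong Rel s s' \<Longrightarrow> alg_cong Rel t t' \<Longrightarrow> alg_cong Rel (Add s t) (Add s' t')"
| scale: "alg_cong Rel t t' \<Longrightarrow> alg_cong Rel (Scale a t) (Scale a t')"
| mult: "alg_cong Rel s s' \<Longrightarrow> alg_cong Rel t t' \<Longrightarrow> alg_cong Rel (Mult s t) (Mult s' t')"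
| add_assoc: "alg_cong Rel (Add (Add s t) u) (Add s (Add t u))"
| add_comm: "alg_cong Rel (Add s t) (Add t s)"
| add_zero: "alg_cong Rel (Add Zero t) t"
| add_inverse: "alg_cong Rel (Add (Scale (- 1) t) t) Zero"
| scale_add_right: "alg_cong Rel (Scale a (Add s t)) (Add (Scale a s) (Scale a t))"
| scale_add_left: "alg_cong Rel (Scale (a + b) t) (Add (Scale a t) (Scale b t))"
| scale_scale: "alg_cong Rel (Scale a (Scale b t)) (Scale (a * b) t)"
| scale_one: "alg_cong Rel (Scale 1 t) t"
| mult_assoc: "alg_cong Rel (Mult (Mult s t) u) (Mult s (Mult t u))"
| mult_add_left: "alg_cong Rel (Mult (Add s t) u) (Add (Mult s u) (Mult t u))"
| mult_add_right: "alg_cong Rel (Mult s (Add t u)) (Add (Mult s t) (Mult s u))"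
| scale_mult_left: "alg_cong Rel (Mult (Scale a s) t) (Scale a (Mult s t))"
| scale_mult_right: "alg_cong Rel (Mult s (Scale a t)) (Scale a (Mult s t))"

definition alg_terms :: "'x set \<Rightarrow> ('x, 'k) alg_term set" where
  "alg_terms X = {t. gens t \<subseteq> X}"

definition alg_rel :: "'x set \<Rightarrow> ('x, 'k::field) alg_term rel \<Rightarrow> ('x, 'k) alg_term rel" where
  "alg_rel X Rel = {(s, t). s \<in> alg_terms X \<and> t \<in> alg_terms X \<and> alg_cong Rel s t}"

definition alg_class ::
  "'x set \<Rightarrow> ('x, 'k::field) alg_term rel \<Rightarrow> ('x, 'k) alg_term \<Rightarrow> ('x, 'k) alg_term set" where
  "alg_class X Rel t = alg_rel X Rel `` {t}"

text \<open>The operations are those of terms, applied to arbitrary representatives; they are well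
  defined by \<open>presented_algebra_simps\<close> below. There is no identity in general, so \<open>one\<close> is
  left unspecified.\<close>

definition presented_algebra ::
  "'x set \<Rightarrow> ('x, 'k::field) alg_term rel \<Rightarrow> ('k, ('x, 'k) alg_term set) module" where
  "presented_algebra X Rel =
    \<lparr>carrier = alg_terms X // alg_rel X Rel,
     mult = (\<lambda>A B. \<Union>s\<in>A. \<Union>t\<in>B. alg_class X Rel (Mult s t)),
     one = undefined,
     zero = alg_class X Rel Zero,
     add = (\<lambda>A B. \<Union>s\<in>A. \<Union>t\<in>B. alg_class X Rel (Add s t)),
     smult = (\<lambda>a A. \<Union>t\<in>A. alg_class X Rel (Scale a t))\<rparr>"


section \<open>Leavitt path algebras\<close>

text \<open>In a \<open>pre_digraph\<close>, the source of an edge is its \<open>tail\<close> and the range is its \<open>head\<close>.\<close>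

definition regular_vertex :: "('v, 'e) pre_digraph \<Rightarrow> 'v \<Rightarrow> bool" where
  "regular_vertex E v \<longleftrightarrow> v \<in> verts E \<and> finite (out_arcs E v) \<and> out_arcs E v \<noteq> {}"

datatype ('v, 'e) lpa_gen = Vertex 'v | Edge 'e | Ghost 'e

definition lpa_gens :: "('v, 'e) pre_digraph \<Rightarrow> ('v, 'e) lpa_gen set" where
  "lpa_gens E = Vertex ` verts E \<union> Edge ` arcs E \<union> Ghost ` arcs E"

text \<open>In the last relation, the sum over the finite set of edges starting at a regular vertex is
  taken along an arbitrary enumeration \<open>es\<close> of that set.\<close>

inductive_set lpa_rels ::
  "('v, 'e) pre_digraph \<Rightarrow> (('v, 'e) lpa_gen, 'k::field) alg_term rel" for E where
  vertex_idem: "v \<in> verts E \<Longrightarrow>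
    (Mult (Gen (Vertex v)) (Gen (Vertex v)), Gen (Vertex v)) \<in> lpa_rels E"
| vertex_orth: "v \<in> verts E \<Longrightarrow> w \<in> verts E \<Longrightarrow> v \<noteq> w \<Longrightarrow>
    (Mult (Gen (Vertex v)) (Gen (Vertex w)), Zero) \<in> lpa_rels E"
| source_edge: "e \<in> arcs E \<Longrightarrow>
    (Mult (Gen (Vertex (tail E e))) (Gen (Edge e)), Gen (Edge e)) \<in> lpa_rels E"
| edge_range: "e \<in> arcs E \<Longrightarrow>
    (Mult (Gen (Edge e)) (Gen (Vertex (head E e))), Gen (Edge e)) \<in> lpa_rels E"
| range_ghost: "e \<in> arcs E \<Longrightarrow>
    (Mult (Gen (Vertex (head E e))) (Gen (Ghost e)), Gen (Ghost e)) \<in> lpa_rels E"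
| ghost_source: "e \<in> arcs E \<Longrightarrow>
    (Mult (Gen (Ghost e)) (Gen (Vertex (tail E e))), Gen (Ghost e)) \<in> lpa_rels E"
| ghost_edge_same: "e \<in> arcs E \<Longrightarrow>
    (Mult (Gen (Ghost e)) (Gen (Edge e)), Gen (Vertex (head E e))) \<in> lpa_rels E"
| ghost_edge_diff: "e \<in> arcs E \<Longrightarrow> f \<in> arcs E \<Longrightarrow> e \<noteq> f \<Longrightarrow>
    (Mult (Gen (Ghost e)) (Gen (Edge f)), Zero) \<in> lpa_rels E"
| regular_sum: "regular_vertex E v \<Longrightarrow> distinct es \<Longrightarrow> set es = out_arcs E v \<Longrightarrow>
    (Gen (Vertex v), foldr (\<lambda>e t. Add (Mult (Gen (Edge e)) (Gen (Ghost e))) t) es Zero)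
      \<in> lpa_rels E"

type_synonym ('v, 'e, 'k) lpa = "(('v, 'e) lpa_gen, 'k) alg_term set"

definition leavitt_path_algebra ::
  "('v, 'e) pre_digraph \<Rightarrow> ('k::field, ('v, 'e, 'k) lpa) module" where
  "leavitt_path_algebra E = presented_algebra (lpa_gens E) (lpa_rels E)"


section \<open>Condition (K)\<close>

definition simple_closed_path :: "('v, 'e) pre_digraph \<Rightarrow> 'v \<Rightarrow> 'e list \<Rightarrow> bool" where
  "simple_closed_path E v p \<longleftrightarrow>
     p \<noteq> [] \<and> pre_digraph.awalk E v p v \<and> (\<forall>e\<in>set (tl p). tail E e \<noteq> v)"

definition condition_K :: "('v, 'e) pre_digraph \<Rightarrow> bool" where
  "condition_K E \<longleftrightarrow> (\<forall>v\<in>verts E. \<forall>c. simple_closed_path E v c \<longrightarrow>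
     (\<exists>c'. simple_closed_path E v c' \<and> c' \<noteq> c))"


section \<open>The definitions are adequate\<close>

lemma equiv_alg_rel: "equiv (alg_terms X) (alg_rel X Rel)"
  by (rule equivI)
    (auto simp: alg_rel_def refl_on_def sym_def trans_def
      intro: alg_cong.refl alg_cong.sym alg_cong.trans)

lemma alg_terms_simps [simp]:
  "Gen x \<in> alg_terms X \<longleftrightarrow> x \<in> X"
  "Zero \<in> alg_terms X"
  "Add s t \<in> alg_terms X \<longleftrightarrow> s \<in> alg_terms X \<and> t \<in> alg_terms X"
  "Scale a t \<in> alg_terms X \<longleftrightarrow> t \<in> alg_terms X"
  "Mult s t \<in> alg_terms X \<longleftrightarrow> s \<in> alg_terms X \<and> t \<in> alg_terms X"
  by (auto simp: alg_terms_def)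

lemma alg_class_eq_iff:
  assumes "s \<in> alg_terms X" "t \<in> alg_terms X"
  shows "alg_class X Rel s = alg_class X Rel t \<longleftrightarrow> alg_cong Rel s t"
  unfolding alg_class_def
  using eq_equiv_class_iff[OF equiv_alg_rel assms, of Rel] assms by (auto simp: alg_rel_def)

lemma mem_alg_class:
  "s \<in> alg_terms X \<Longrightarrow> t \<in> alg_class X Rel s \<longleftrightarrow> t \<in> alg_terms X \<and> alg_cong Rel s t"
  by (auto simp: alg_class_def alg_rel_def)

lemma presented_algebra_simps:
  fixes X :: "'x set" and Rel :: "('x, 'k::field) alg_term rel"
  assumes s: "s \<in> alg_terms X" and t: "t \<in> alg_terms X"
  shows "alg_class X Rel s \<otimes>\<^bsub>presented_algebra X Rel\<^esub> alg_class X Rel t = alg_class X Rel (Mult s t)"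
    and "alg_class X Rel s \<oplus>\<^bsub>presented_algebra X Rel\<^esub> alg_class X Rel t = alg_class X Rel (Add s t)"
    and "a \<odot>\<^bsub>presented_algebra X Rel\<^esub> alg_class X Rel t = alg_class X Rel (Scale a t)"
proof -
  let ?c = "alg_class X Rel"
  have self: "u \<in> ?c u" if "u \<in> alg_terms X" for u
    using that by (simp add: mem_alg_class alg_cong.refl)
  have *: "?c (Mult s' t') = ?c (Mult s t)" "?c (Add s' t') = ?c (Add s t)"
      "?c (Scale a t') = ?c (Scale a t)"
    if "s' \<in> ?c s" "t' \<in> ?c t" for s' t'
    using that s t
    by (simp_all add: mem_alg_class alg_class_eq_iff alg_cong.mult alg_cong.add alg_cong.scale
        alg_cong.sym)
  have UN: "(\<Union>s'\<in>A. F s') = C" if "a \<in> A" "\<And>s'. s' \<in> A \<Longrightarrow> F s' = C"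
    for a A C and F :: "('x, 'k) alg_term \<Rightarrow> ('x, 'k) alg_term set"
    using that by auto
  have "(\<Union>s'\<in>?c s. \<Union>t'\<in>?c t. ?c (Mult s' t')) = ?c (Mult s t)"
    by (intro UN[OF self[OF s]] UN[OF self[OF t]] *(1))
  then show "?c s \<otimes>\<^bsub>presented_algebra X Rel\<^esub> ?c t = ?c (Mult s t)"
    by (simp add: presented_algebra_def)
  have "(\<Union>s'\<in>?c s. \<Union>t'\<in>?c t. ?c (Add s' t')) = ?c (Add s t)"
    by (intro UN[OF self[OF s]] UN[OF self[OF t]] *(2))
  then show "?c s \<oplus>\<^bsub>presented_algebra X Rel\<^esub> ?c t = ?c (Add s t)"
    by (simp add: presented_algebra_def)
  have "(\<Union>t'\<in>?c t. ?c (Scale a t')) = ?c (Scale a t)"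
    by (intro UN[OF self[OF t]] *(3)[OF self[OF s]])
  then show "a \<odot>\<^bsub>presented_algebra X Rel\<^esub> ?c t = ?c (Scale a t)"
    by (simp add: presented_algebra_def)
qed

lemma presented_algebra_carrier:
  "carrier (presented_algebra X Rel) = alg_class X Rel ` alg_terms X"
  by (auto simp: presented_algebra_def quotient_def alg_class_def)

lemma presented_algebra_zero: "\<zero>\<^bsub>presented_algebra X Rel\<^esub> = alg_class X Rel Zero"
  by (simp add: presented_algebra_def)

lemma rng_presented_algebra: "rng (presented_algebra X Rel)"
proof -
  note simps = presented_algebra_carrier presented_algebra_zero presented_algebra_simps
    alg_class_eq_iff
  have "abelian_group (presented_algebra X Rel)"
  proof (rule abelian_groupI)
    fix x assume "x \<in> carrier (presented_algebra X Rel)"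
    then obtain t where t: "t \<in> alg_terms X" "x = alg_class X Rel t"
      by (auto simp: simps)
    then show "\<exists>y\<in>carrier (presented_algebra X Rel).
        y \<oplus>\<^bsub>presented_algebra X Rel\<^esub> x = \<zero>\<^bsub>presented_algebra X Rel\<^esub>"
      by (intro bexI[of _ "alg_class X Rel (Scale (- 1) t)"])
        (simp_all add: simps alg_cong.add_inverse)
  qed (clarsimp simp: simps alg_cong.add_assoc alg_cong.add_comm alg_cong.add_zero)+
  then show ?thesis
    by (intro rng.intro rng_axioms.intro)
      (clarsimp simp: simps alg_cong.mult_assoc alg_cong.mult_add_left alg_cong.mult_add_right)+
qed

lemma rng_leavitt_path_algebra: "rng (leavitt_path_algebra E)"
  by (simp add: leavitt_path_algebra_def rng_presented_algebra)

lemma simple_left_module_cyclic: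
  fixes M :: "('a, 'm, 'c) module_scheme"
  assumes "simple_left_module R M"
  obtains x where "x \<in> carrier M" "carrier M = (\<lambda>r. r \<odot>\<^bsub>M\<^esub> x) ` carrier R"
proof -
  interpret rng_left_module R M
    using assms by (simp add: simple_left_module_def)
  obtain r x where r: "r \<in> carrier R" and x: "x \<in> carrier M" and rx: "r \<odot>\<^bsub>M\<^esub> x \<noteq> \<zero>\<^bsub>M\<^esub>"
    using assms by (auto simp: simple_left_module_def)
  have zero_l: "\<zero>\<^bsub>R\<^esub> \<odot>\<^bsub>M\<^esub> y = \<zero>\<^bsub>M\<^esub>" if "y \<in> carrier M" for y
  proof -
    let ?z = "\<zero>\<^bsub>R\<^esub> \<odot>\<^bsub>M\<^esub> y"
    have z: "?z \<in> carrier M"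
      using that by (simp add: lm_smult_closed)
    have "?z \<oplus>\<^bsub>M\<^esub> ?z = ?z"
      using lm_smult_l_distr[of "\<zero>\<^bsub>R\<^esub>" "\<zero>\<^bsub>R\<^esub>" y] that by simp
    then show ?thesis
      using M.add.l_cancel_one[OF z z] by simp
  qed
  have neg: "\<ominus>\<^bsub>M\<^esub> (a \<odot>\<^bsub>M\<^esub> y) = (\<ominus>\<^bsub>R\<^esub> a) \<odot>\<^bsub>M\<^esub> y"
    if "a \<in> carrier R" "y \<in> carrier M" for a y
    using that lm_smult_l_distr[of "\<ominus>\<^bsub>R\<^esub> a" a y]
    by (intro M.minus_equality) (simp_all add: lm_smult_closed R.l_neg zero_l)
  let ?N = "(\<lambda>r. r \<odot>\<^bsub>M\<^esub> x) ` carrier R"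
  have "submodule ?N R M"
  proof (intro submodule.intro submodule_axioms.intro M.add.subgroupI)
    fix a y assume "a \<in> carrier R" "y \<in> ?N"
    then show "a \<odot>\<^bsub>M\<^esub> y \<in> ?N"
      using x by (auto simp: lm_smult_assoc[symmetric] rng_m_closed)
  next
    fix y z assume "y \<in> ?N" "z \<in> ?N"
    then obtain a b where "a \<in> carrier R" "b \<in> carrier R" "y = a \<odot>\<^bsub>M\<^esub> x" "z = b \<odot>\<^bsub>M\<^esub> x"
      by auto
    then show "y \<oplus>\<^bsub>M\<^esub> z \<in> ?N"
      using x by (auto simp: lm_smult_l_distr[symmetric])
  next
    fix y assume "y \<in> ?N"
    then obtain a where "a \<in> carrier R" "y = a \<odot>\<^bsub>M\<^esub> x"
      by auto
    then show "\<ominus>\<^bsub>M\<^esub> y \<in> ?N"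
      using x by (auto simp: neg)
  qed (use x r in \<open>auto simp: lm_smult_closed\<close>)
  moreover have "?N \<noteq> {\<zero>\<^bsub>M\<^esub>}"
    using r rx by auto
  ultimately have "carrier M = ?N"
    using assms unfolding simple_left_module_def by metis
  then show thesis
    using that x by blast
qed

lemma primitive_rng_idealI:
  fixes R :: "('a, 'b) ring_scheme" and M :: "('a, 'm, 'c) module_scheme"
  assumes simple: "simple_left_module R M"
  shows "primitive_rng_ideal (left_annihilator R M) R"
proof -
  interpret rng_left_module R M
    using simple by (simp add: simple_left_module_def)
  obtain x where x: "x \<in> carrier M" "carrier M = (\<lambda>r. r \<odot>\<^bsub>M\<^esub> x) ` carrier R"
    using simple_left_module_cyclic[OF simple] .
  define f where "f y = {r \<in> carrier R. r \<odot>\<^bsub>M\<^esub> x = y}" for y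
  define g where "g = the_inv_into (carrier M) f"
  have inj: "inj_on f (carrier M)"
  proof (rule inj_onI)
    fix y z assume "y \<in> carrier M" "z \<in> carrier M" and eq: "f y = f z"
    then obtain r where "r \<in> carrier R" "r \<odot>\<^bsub>M\<^esub> x = y"
      using x by auto
    then have "r \<in> f y"
      by (simp add: f_def)
    then have "r \<in> f z"
      using eq by simp
    with \<open>r \<odot>\<^bsub>M\<^esub> x = y\<close> show "y = z"
      by (simp add: f_def)
  qed
  have gf [simp]: "g (f y) = y" if "y \<in> carrier M" for y
    using inj that by (simp add: g_def the_inv_into_f_f)
  define M' :: "('a, 'a set) module" where
    "M' = \<lparr>carrier = f ` carrier M, mult = undefined, one = undefined, zero = f \<zero>\<^bsub>M\<^esub>,
       add = (\<lambda>y z. f (g y \<oplus>\<^bsub>M\<^esub> g z)), smult = (\<lambda>r y. f (r \<odot>\<^bsub>M\<^esub> g y))\<rparr>"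
  have M' [simp]: "carrier M' = f ` carrier M" "\<zero>\<^bsub>M'\<^esub> = f \<zero>\<^bsub>M\<^esub>"
    "y \<oplus>\<^bsub>M'\<^esub> z = f (g y \<oplus>\<^bsub>M\<^esub> g z)" "r \<odot>\<^bsub>M'\<^esub> y = f (r \<odot>\<^bsub>M\<^esub> g y)" for r y z
    by (simp_all add: M'_def)
  have f_eq [simp]: "f y = f z \<longleftrightarrow> y = z" if "y \<in> carrier M" "z \<in> carrier M" for y z
    using inj that by (auto dest: inj_onD)
  have M'_group: "abelian_group M'"
  proof (rule abelian_groupI)
    fix y assume "y \<in> carrier M'"
    then obtain y' where "y' \<in> carrier M" "y = f y'"
      by auto
    then show "\<exists>z\<in>carrier M'. z \<oplus>\<^bsub>M'\<^esub> y = \<zero>\<^bsub>M'\<^esub>"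
      by (intro bexI[of _ "f (\<ominus>\<^bsub>M\<^esub> y')"]) (auto simp: M.l_neg)
  qed (auto simp: M.a_assoc M.a_comm M.a_lcomm)
  interpret M': abelian_group M'
    by fact
  have M'_module: "rng_left_module R M'"
    by (intro rng_left_module.intro rng_left_module_axioms.intro R.rng_axioms M'_group)
      (auto simp: lm_smult_closed lm_smult_l_distr lm_smult_r_distr lm_smult_assoc rng_m_closed)
  have "N = {\<zero>\<^bsub>M'\<^esub>} \<or> N = carrier M'" if "submodule N R M'" for N
  proof -
    interpret N: submodule N R M'
      by fact
    have N_sub: "N \<subseteq> f ` carrier M"
      using N.subset by simp
    then have gN: "g y \<in> carrier M" "f (g y) = y" if "y \<in> N" for y
      using that by auto
    have closed: "f (g y \<oplus>\<^bsub>M\<^esub> g z) \<in> N" if "y \<in> N" "z \<in> N" for y z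
      using N.m_closed[OF that] by simp
    have "\<zero>\<^bsub>M\<^esub> \<in> g ` N"
      using N.one_closed by (force intro: image_eqI[of _ _ "f \<zero>\<^bsub>M\<^esub>"])
    have "submodule (g ` N) R M"
    proof (intro submodule.intro submodule_axioms.intro M.add.subgroupI)
      show "g ` N \<subseteq> carrier M"
        using gN by auto
      show "g ` N \<noteq> {}"
        using \<open>\<zero>\<^bsub>M\<^esub> \<in> g ` N\<close> by auto
    next
      fix y z assume "y \<in> g ` N" "z \<in> g ` N"
      then obtain y' z' where yz: "y' \<in> N" "z' \<in> N" "y = g y'" "z = g z'"
        by auto
      then show "y \<oplus>\<^bsub>M\<^esub> z \<in> g ` N"
        using closed[of y' z'] gN by (intro image_eqI[of _ _ "f (y \<oplus>\<^bsub>M\<^esub> z)"]) auto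
    next
      fix a y assume "a \<in> carrier R" "y \<in> g ` N"
      then obtain y' where y: "y' \<in> N" "y = g y'"
        by auto
      then show "a \<odot>\<^bsub>M\<^esub> y \<in> g ` N"
        using N.smult_closed[OF \<open>a \<in> carrier R\<close> y(1)] gN \<open>a \<in> carrier R\<close>
        by (intro image_eqI[of _ _ "f (a \<odot>\<^bsub>M\<^esub> y)"]) (auto simp: lm_smult_closed)
    next
      fix y assume "y \<in> g ` N"
      then obtain y' where y: "y' \<in> N" "y = g y'"
        by auto
      let ?z = "\<ominus>\<^bsub>M'\<^esub> y'"
      have z: "?z \<in> N"
        using N.m_inv_closed[OF y(1)] by (simp add: a_inv_def)
      have "?z \<oplus>\<^bsub>M'\<^esub> y' = \<zero>\<^bsub>M'\<^esub>"
        using N_sub y(1) by (intro M'.l_neg) auto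
      then have "g ?z \<oplus>\<^bsub>M\<^esub> g y' = \<zero>\<^bsub>M\<^esub>"
        using gN[OF z] gN[OF y(1)] by simp
      then have "\<ominus>\<^bsub>M\<^esub> y = g ?z"
        using gN[OF z] gN[OF y(1)] y(2) by (intro M.minus_equality) auto
      then show "\<ominus>\<^bsub>M\<^esub> y \<in> g ` N"
        using z by auto
    qed
    then have "g ` N = {\<zero>\<^bsub>M\<^esub>} \<or> g ` N = carrier M"
      using simple by (simp add: simple_left_module_def)
    moreover have "N = f ` g ` N"
      using gN by (force simp: image_image)
    ultimately show ?thesis
      by auto
  qed
  moreover have "\<exists>r\<in>carrier R. \<exists>y\<in>carrier M'. r \<odot>\<^bsub>M'\<^esub> y \<noteq> \<zero>\<^bsub>M'\<^esub>"
    using simple by (auto simp: simple_left_module_def lm_smult_closed)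
  ultimately have "simple_left_module R M'"
    using M'_module unfolding simple_left_module_def by blast
  moreover have "left_annihilator R M = left_annihilator R M'"
    by (auto simp: left_annihilator_def lm_smult_closed)
  ultimately show ?thesis
    unfolding primitive_rng_ideal_def by blast
qed

end

theory Submission
  imports Defs "HOL-Library.Function_Algebras" "HOL-Library.Product_Plus" "HOL-Library.Sublist"
begin

text \<open>Assume Condition (K), and let \<open>a\<close> lie outside the ideal \<open>I\<close>. Modulo \<open>I\<close>, multiplying \<open>a\<close>
  on the right by edges removes ghost edges; if every edge kills \<open>a\<close>, then \<open>a\<close> is a combination of
  real paths times an idempotent \<open>v - \<Sum>ee\<^sup>*\<close>. The ghost of a shortest of these paths reduces \<open>a\<close>
  to a scalar multiple of a vertex plus closed paths, and the closed paths are separated from the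
  vertex by conjugating with \<open>c\<^sup>m c'\<close>, where \<open>c \<noteq> c'\<close> are simple closed paths at the vertex.
  So the ideal generated by \<open>a\<close> contains an element that is a nonzero idempotent modulo \<open>I\<close>, and
  Zorn's lemma yields a primitive ideal above \<open>I\<close> that avoids it.

  Conversely, if \<open>c\<close> is the only simple closed path at \<open>v\<close>, there is a representation over the
  dual numbers in which \<open>v + c\<close> acts as \<open>\<epsilon> v\<close>. The elements annihilated by \<open>\<epsilon>\<close> form an ideal that is
  not contained in the kernel although its square is, so the kernel is not an intersection of
  prime ideals.\<close>


section \<open>Additive endomorphisms and evaluation of terms\<close>

text \<open>The circle is (iii) => (i) => (ii) => (iii); the middle step holds because primitive
  ideals are prime. The ideal \<open>I\<close> is arbitrary, so \<open>L / I\<close> need not be a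
  Leavitt path algebra again. All computations therefore take place in an image of \<open>L\<close>
  in which vertices and edges may vanish: nonvanishing has to be tracked, and at a vertex with
  infinitely many edges only finite partial sums of \<open>e e*\<close> exist. Since
  \<open>L\<close> and its quotients are carried by sets and lack an identity, they are represented
  by additive endomorphisms of an abelian group. These form a type of class \<open>ring\<close> with
  identity, where ordinary simplification works and scalars become elements commuting with the
  generators. Both directions use such a representation. The dual numbers come from the Laurent
  polynomials \<open>K[x, 1/x]\<close> that a unique simple closed path contributes at its base:
  \<open>(1 + x)^2\<close> generates an ideal that is not semiprime, and the quotient by it is
  \<open>K[eps]\<close> with \<open>x = -1 + eps\<close>.\<close>

typedef (overloaded) 'a endo = "{f :: 'a::ab_group_add \<Rightarrow> 'a. \<forall>x y. f (x + y) = f x + f y}"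
  morphisms app Endo
  by (rule exI[of _ "\<lambda>x. x"]) simp

setup_lifting type_definition_endo

lemma app_add_right: "app f (x + y) = app f x + app f y"
  using app[of f] by simp

lemma endo_eqI: "(\<And>x. app f x = app g x) \<Longrightarrow> f = g"
  by (simp add: app_inject[symmetric] fun_eq_iff)

instantiation endo :: (ab_group_add) "{zero, one, plus, minus, uminus, times}"
begin

lift_definition zero_endo :: "'a endo" is "\<lambda>_. 0" by simp
lift_definition one_endo :: "'a endo" is "\<lambda>x. x" by simp
lift_definition plus_endo :: "'a endo \<Rightarrow> 'a endo \<Rightarrow> 'a endo" is "\<lambda>f g x. f x + g x"
  by (simp add: add_ac)
lift_definition minus_endo :: "'a endo \<Rightarrow> 'a endo \<Rightarrow> 'a endo" is "\<lambda>f g x. f x - g x"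
  by (metis add_diff_add)
lift_definition uminus_endo :: "'a endo \<Rightarrow> 'a endo" is "\<lambda>f x. - f x"
  by (metis minus_add_distrib)
lift_definition times_endo :: "'a endo \<Rightarrow> 'a endo \<Rightarrow> 'a endo" is "\<lambda>f g x. f (g x)"
  by metis

instance ..

end

lemma app_simps [simp]:
  "app 0 x = 0" "app 1 x = x" "app (f + g) x = app f x + app g x"
  "app (f - g) x = app f x - app g x" "app (- f) x = - app f x" "app (f * g) x = app f (app g x)"
  by (simp_all add: zero_endo.rep_eq one_endo.rep_eq plus_endo.rep_eq minus_endo.rep_eq
      uminus_endo.rep_eq times_endo.rep_eq)

instance endo :: (ab_group_add) "{ring, monoid_mult}"
  by standard (rule endo_eqI; simp add: app_add_right add_ac)+

text \<open>Type class \<open>ring\<close> has no scalar multiplication, so a scalar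
  \<open>a\<close> acts as left multiplication by a ring element \<open>sc a\<close>.\<close>

primrec alg_eval ::
  "('k \<Rightarrow> 'a::{ring, monoid_mult}) \<Rightarrow> ('x \<Rightarrow> 'a) \<Rightarrow> ('x, 'k) alg_term \<Rightarrow> 'a" where
  "alg_eval sc \<rho> (Gen x) = \<rho> x"
| "alg_eval sc \<rho> Zero = 0"
| "alg_eval sc \<rho> (Add s t) = alg_eval sc \<rho> s + alg_eval sc \<rho> t"
| "alg_eval sc \<rho> (Scale a t) = sc a * alg_eval sc \<rho> t"
| "alg_eval sc \<rho> (Mult s t) = alg_eval sc \<rho> s * alg_eval sc \<rho> t"

lemma alg_eval_commute:
  fixes z :: "'a::{ring, monoid_mult}"
  assumes "\<And>a. z * sc a = sc a * z" and "\<And>x. z * \<rho> x = \<rho> x * z"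
  shows "z * alg_eval sc \<rho> t = alg_eval sc \<rho> t * z"
proof (induction t)
  case (Scale a t)
  have "z * (sc a * alg_eval sc \<rho> t) = sc a * (z * alg_eval sc \<rho> t)"
    by (metis assms(1) mult.assoc)
  then show ?case
    by (simp add: Scale mult.assoc)
next
  case (Mult s t)
  have "z * (alg_eval sc \<rho> s * alg_eval sc \<rho> t) = alg_eval sc \<rho> s * (z * alg_eval sc \<rho> t)"
    by (metis Mult(1) mult.assoc)
  then show ?case
    by (simp add: Mult mult.assoc)
qed (simp_all add: assms algebra_simps)

text \<open>Commutation with the generators suffices: by \<open>alg_eval_commute\<close> the scalars
  then commute with the whole image, as \<open>scale_mult_right\<close> requires.\<close>

locale central_scalars =
  fixes sc :: "'k::field \<Rightarrow> 'a::{ring, monoid_mult}" and \<rho> :: "'x \<Rightarrow> 'a"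
  assumes sc_add: "sc (a + b) = sc a + sc b"
    and sc_mult: "sc (a * b) = sc a * sc b"
    and sc_one: "sc 1 = 1"
    and sc_gen: "sc a * \<rho> x = \<rho> x * sc a"
begin

abbreviation ev :: "('x, 'k) alg_term \<Rightarrow> 'a" where
  "ev \<equiv> alg_eval sc \<rho>"

lemma sc_zero [simp]: "sc 0 = 0"
  using sc_add[of 0 0] by simp

lemma sc_minus_one: "sc (- 1) = - 1"
  using sc_add[of "-1" 1] by (simp add: sc_one eq_neg_iff_add_eq_0)

lemma sc_sc: "sc a * sc b = sc b * sc a"
  by (simp add: sc_mult[symmetric] mult.commute)

lemma sc_ev: "sc a * ev t = ev t * sc a"
  by (rule alg_eval_commute) (simp_all add: sc_sc sc_gen)

lemma ev_cong:
  assumes "alg_cong Rel s t" and "\<And>s t. (s, t) \<in> Rel \<Longrightarrow> ev s = ev t"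
  shows "ev s = ev t"
  using assms(1)
proof induction
  case (scale_mult_right s a t)
  then show ?case
    by (metis alg_eval.simps(4,5) mult.assoc sc_ev)
qed (simp_all add: assms(2) sc_add sc_mult sc_one sc_minus_one algebra_simps)

end

section \<open>The free algebra\<close>

\<comment> \<open>The presented algebra depends on a graph and lives on a set, whereas the free
  algebra can be a type. It supplies ring and vector space reasoning about terms, and it is the
  space on which the quotients of \<open>L\<close> act.\<close>
quotient_type (overloaded) ('x, 'k) free_alg = "('x, 'k::field) alg_term" / "alg_cong {}"
  by (intro equivpI reflpI sympI transpI) (fact alg_cong.refl alg_cong.sym alg_cong.trans)+

lemmas alg_cong_axioms = alg_cong.add_assoc alg_cong.add_comm alg_cong.add_zero
  alg_cong.add_inverse alg_cong.mult_assoc alg_cong.mult_add_left alg_cong.mult_add_right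
  alg_cong.scale_add_right alg_cong.scale_add_left alg_cong.scale_scale alg_cong.scale_one
  alg_cong.scale_mult_left alg_cong.scale_mult_right alg_cong.refl

instantiation free_alg :: (type, field) ring
begin

lift_definition zero_free_alg :: "('a, 'b) free_alg" is Zero .
lift_definition plus_free_alg :: "('a, 'b) free_alg \<Rightarrow> ('a, 'b) free_alg \<Rightarrow> ('a, 'b) free_alg"
  is Add by (rule alg_cong.add)
lift_definition times_free_alg :: "('a, 'b) free_alg \<Rightarrow> ('a, 'b) free_alg \<Rightarrow> ('a, 'b) free_alg"
  is Mult by (rule alg_cong.mult)
lift_definition uminus_free_alg :: "('a, 'b) free_alg \<Rightarrow> ('a, 'b) free_alg"
  is "Scale (- 1)" by (rule alg_cong.scale)
lift_definition minus_free_alg :: "('a, 'b) free_alg \<Rightarrow> ('a, 'b) free_alg \<Rightarrow> ('a, 'b) free_alg"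
  is "\<lambda>s t. Add s (Scale (- 1) t)" by (intro alg_cong.add alg_cong.scale)

instance
  by (standard; transfer; rule alg_cong_axioms)

end

lift_definition fscale :: "'k \<Rightarrow> ('x, 'k::field) free_alg \<Rightarrow> ('x, 'k) free_alg"
  is Scale by (rule alg_cong.scale)

global_interpretation free_alg: vector_space fscale
  by (standard; transfer; rule alg_cong_axioms)

lemma fscale_mult: "fscale a x * y = fscale a (x * y)" "x * fscale a y = fscale a (x * y)"
  by (transfer; rule alg_cong_axioms)+


section \<open>Faithful representations of quotients\<close>

text \<open>Every congruence contains the free one, so an algebra identity proved by simplification
  in \<open>free_alg\<close> transfers to \<open>alg_cong Rel\<close>.\<close>

lemma free_alg_eqD:
  assumes "abs_free_alg s = abs_free_alg t"
  shows "alg_cong Rel s t"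
proof -
  have "alg_cong {} s t"
    using assms by (simp add: free_alg.abs_eq_iff)
  then show ?thesis
    by induction (auto intro: alg_cong.refl alg_cong.sym alg_cong.trans alg_cong.add alg_cong.scale
        alg_cong.mult alg_cong_axioms)
qed

lemma free_alg_cases: obtains t where "x = abs_free_alg t"
  by (induction x rule: free_alg.abs_induct) blast

lemmas abs_free_alg_simps = zero_free_alg.abs_eq[symmetric] plus_free_alg.abs_eq[symmetric]
  times_free_alg.abs_eq[symmetric] fscale.abs_eq[symmetric]

lemma alg_cong_mult_zero: "alg_cong Rel (Mult s Zero) Zero"
  by (rule free_alg_eqD) (simp add: abs_free_alg_simps)

lemma alg_cong_diff:
  assumes "alg_cong Rel s t"
  shows "alg_cong Rel (Add s (Scale (- 1) t)) Zero"
proof -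
  have "alg_cong Rel (Add s (Scale (- 1) t)) (Add s (Scale (- 1) s))"
    by (intro alg_cong.add alg_cong.scale alg_cong.refl alg_cong.sym[OF assms])
  moreover have "alg_cong Rel (Add s (Scale (- 1) s)) Zero"
    by (rule free_alg_eqD) (simp add: abs_free_alg_simps)
  ultimately show ?thesis
    by (rule alg_cong.trans)
qed

text \<open>The type \<open>free_alg\<close> also contains generators outside \<open>X\<close>.
  Sending them to zero is a retraction onto the terms over \<open>X\<close>, along which an ideal of
  the presented algebra is pulled back to the whole free algebra.\<close>

primrec restrict_gens :: "'x set \<Rightarrow> ('x, 'k) alg_term \<Rightarrow> ('x, 'k) alg_term" where
  "restrict_gens X (Gen x) = (if x \<in> X then Gen x else Zero)"
| "restrict_gens X Zero = Zero"
| "restrict_gens X (Add s t) = Add (restrict_gens X s) (restrict_gens X t)"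
| "restrict_gens X (Scale a t) = Scale a (restrict_gens X t)"
| "restrict_gens X (Mult s t) = Mult (restrict_gens X s) (restrict_gens X t)"

lemma restrict_gens_closed: "restrict_gens X t \<in> alg_terms X"
  by (induction t) simp_all

lemma restrict_gens_id: "t \<in> alg_terms X \<Longrightarrow> restrict_gens X t = t"
  by (induction t) simp_all

lemma alg_cong_restrict_gens:
  assumes "alg_cong {} s t"
  shows "alg_cong {} (restrict_gens X s) (restrict_gens X t)"
  using assms
  by induction (auto intro: alg_cong.refl alg_cong.sym alg_cong.trans alg_cong.add alg_cong.scale
        alg_cong.mult alg_cong_axioms)

text \<open>Let \<open>p\<close> be a linear map on the free algebra whose kernel is the preimage \<open>J\<close> of \<open>I\<close> and with
  \<open>x - p x \<in> J\<close>. Then \<open>y \<mapsto> (x \<mapsto> p (y x))\<close> is multiplicative, and it embeds the quotient by \<open>I\<close>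
  into a type of class \<open>ring\<close>.\<close>

lemma quotient_representation:
  fixes X :: "'x set" and Rel :: "('x, 'k::field) alg_term rel"
  assumes I: "rng_ideal I (presented_algebra X Rel)"
    and unit: "\<And>t. t \<in> alg_terms X \<Longrightarrow> \<exists>u\<in>alg_terms X. alg_cong Rel (Mult t u) t"
  obtains sc :: "'k \<Rightarrow> ('x, 'k) free_alg endo" and \<rho> where
    "central_scalars sc \<rho>"
    "\<And>t. t \<in> alg_terms X \<Longrightarrow> alg_eval sc \<rho> t = 0 \<longleftrightarrow> alg_class X Rel t \<in> I"
    "\<And>s t. (s, t) \<in> Rel \<Longrightarrow> s \<in> alg_terms X \<Longrightarrow> t \<in> alg_terms X \<Longrightarrow>
      alg_eval sc \<rho> s = alg_eval sc \<rho> t"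
proof -
  interpret rng_ideal I "presented_algebra X Rel"
    by (fact I)
  note rg = restrict_gens_closed[of X]
  note ps = presented_algebra_simps[of _ X _ Rel]
  define in_I where "in_I t \<longleftrightarrow> alg_class X Rel (restrict_gens X t) \<in> I" for t
  have carr: "alg_class X Rel t \<in> carrier (presented_algebra X Rel)" if "t \<in> alg_terms X" for t
    using that by (simp add: presented_algebra_carrier)
  have in_I_cong: "in_I s \<longleftrightarrow> in_I t" if "alg_cong {} s t" for s t
  proof -
    have "abs_free_alg (restrict_gens X s) = abs_free_alg (restrict_gens X t)"
      using alg_cong_restrict_gens[OF that] by (simp add: free_alg.abs_eq_iff)
    then have "alg_class X Rel (restrict_gens X s) = alg_class X Rel (restrict_gens X t)"
      by (simp add: alg_class_eq_iff rg free_alg_eqD)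
    then show ?thesis
      by (simp add: in_I_def)
  qed
  have I_zero: "alg_class X Rel Zero \<in> I"
    using additive_subgroup.zero_closed[OF additive_subgroup_axioms]
    by (simp add: presented_algebra_zero)
  then have in_I_Zero: "in_I Zero"
    by (simp add: in_I_def)
  have in_I_Add: "in_I (Add s t)" if "in_I s" "in_I t" for s t
    using a_closed that by (simp add: in_I_def ps[OF rg rg, symmetric])
  have in_I_Mult: "in_I (Mult s t)" if "in_I s \<or> in_I t" for s t
    using that rng_I_l_closed[OF _ carr[OF rg]] rng_I_r_closed[OF _ carr[OF rg]]
    by (auto simp: in_I_def ps[OF rg rg, symmetric])
  \<comment> \<open>A ring ideal is not assumed to be a subspace. It is one because
    \<open>a t = t (a u)\<close> for a right local unit \<open>u\<close> of
    \<open>t\<close>.\<close>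
  have in_I_Scale: "in_I (Scale a t)" if t: "in_I t" for a t
  proof -
    obtain u where u: "u \<in> alg_terms X"
      and "alg_cong Rel (Mult (restrict_gens X t) u) (restrict_gens X t)"
      using unit[OF rg] by blast
    then have "alg_cong Rel (Scale a (Mult (restrict_gens X t) u)) (Scale a (restrict_gens X t))"
      by (intro alg_cong.scale)
    then have "alg_cong Rel (Mult (restrict_gens X t) (Scale a u)) (Scale a (restrict_gens X t))"
      by (rule alg_cong.trans[OF alg_cong.scale_mult_right])
    then have "alg_class X Rel (Mult (restrict_gens X t) (Scale a u))
        = alg_class X Rel (Scale a (restrict_gens X t))"
      using u by (simp add: alg_class_eq_iff rg)
    moreover have "alg_class X Rel (Mult (restrict_gens X t) (Scale a u)) \<in> I"
      using rng_I_r_closed[of "alg_class X Rel (restrict_gens X t)", OF _ carr[of "Scale a u"]] t u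
      by (simp add: in_I_def ps[OF rg, symmetric])
    ultimately show ?thesis
      by (simp add: in_I_def)
  qed
  define J where "J = abs_free_alg ` Collect in_I"
  have mem_J: "abs_free_alg t \<in> J \<longleftrightarrow> in_I t" for t
    unfolding J_def using in_I_cong by (auto simp: free_alg.abs_eq_iff)
  have J_mult: "x * y \<in> J" if "x \<in> J \<or> y \<in> J" for x y
    using that in_I_Mult
    by (cases x rule: free_alg_cases, cases y rule: free_alg_cases) (simp add: mem_J times_free_alg.abs_eq)
  have J_sub: "free_alg.subspace J"
  proof (rule free_alg.subspaceI)
    show "0 \<in> J"
      by (simp add: zero_free_alg.abs_eq mem_J in_I_Zero)
    show "x + y \<in> J" if "x \<in> J" "y \<in> J" for x y
      using that in_I_Add by (cases x rule: free_alg_cases, cases y rule: free_alg_cases) (simp add: mem_J plus_free_alg.abs_eq)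
    show "fscale a x \<in> J" if "x \<in> J" for a x
      using that in_I_Scale by (cases x rule: free_alg_cases) (simp add: mem_J fscale.abs_eq)
  qed
  interpret vp: vector_space_pair "fscale :: 'k \<Rightarrow> ('x, 'k) free_alg \<Rightarrow> _"
    "fscale :: 'k \<Rightarrow> ('x, 'k) free_alg \<Rightarrow> _" ..
  \<comment> \<open>A linear projection \<open>g\<close> onto the subspace \<open>J\<close>; below,
    \<open>p\<close> is the complementary projection.\<close>
  obtain g where g_range: "range g \<subseteq> J" and g_lin: "Vector_Spaces.linear fscale fscale g"
    and g_id: "\<And>x. x \<in> J \<Longrightarrow> g x = x"
    using vp.linear_exists_left_inverse_on[OF free_alg.linear_id J_sub] by auto
  interpret g: Vector_Spaces.linear fscale fscale g
    by (fact g_lin)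
  define p where "p x = x - g x" for x
  have p_add: "p (x + y) = p x + p y" for x y
    by (simp add: p_def g.add)
  have p_scale: "p (fscale a x) = fscale a (p x)" for a x
    by (simp add: p_def g.scale free_alg.scale_right_diff_distrib)
  have p_0: "p 0 = 0"
    using p_add[of 0 0] by simp
  have p_zero: "p x = 0 \<longleftrightarrow> x \<in> J" for x
    using g_range g_id by (auto simp: p_def)
  \<comment> \<open>As \<open>J\<close> absorbs left factors, \<open>p\<close> may be dropped inside
    a product; this makes \<open>T\<close> multiplicative.\<close>
  have p_mult: "p (y * p x) = p (y * x)" for x y
  proof -
    have "y * p x = y * x - y * g x"
      by (simp add: p_def algebra_simps)
    then have "p (y * p x) = p (y * x) - p (y * g x)"
      by (simp add: p_def g.diff)
    moreover have "y * g x \<in> J"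
      using J_mult g_range by blast
    ultimately show ?thesis
      using p_zero by simp
  qed
  define T where "T y = Endo (\<lambda>x. p (y * x))" for y
  define sc :: "'k \<Rightarrow> ('x, 'k) free_alg endo" where "sc a = Endo (fscale a)" for a
  define \<rho> where "\<rho> x = T (abs_free_alg (Gen x))" for x
  have T: "app (T y) x = p (y * x)" for x y
    unfolding T_def by (subst Endo_inverse) (simp_all add: p_add algebra_simps)
  have sc: "app (sc a) x = fscale a x" for x a
    unfolding sc_def by (subst Endo_inverse) (simp_all add: free_alg.scale_right_distrib)
  have central: "central_scalars sc \<rho>"
    by standard (rule endo_eqI; simp add: sc T \<rho>_def free_alg.scale_left_distrib
        fscale_mult p_scale)+
  then interpret central_scalars sc \<rho> .
  have ev: "ev t = T (abs_free_alg t)" for t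
  proof (induction t)
    case (Gen x)
    then show ?case by (simp add: \<rho>_def)
  qed (rule endo_eqI; simp add: T sc abs_free_alg_simps p_add p_mult p_scale fscale_mult
      p_0 distrib_right mult.assoc)+
  have zero_iff: "ev t = 0 \<longleftrightarrow> alg_class X Rel t \<in> I" if t: "t \<in> alg_terms X" for t
  proof
    assume "ev t = 0"
    \<comment> \<open>\<open>T\<close> sees \<open>t\<close> only through products
      \<open>t x\<close>; the local unit recovers \<open>t\<close> itself.\<close>
    obtain u where u: "u \<in> alg_terms X" "alg_cong Rel (Mult t u) t"
      using unit[OF t] by blast
    have "p (abs_free_alg t * abs_free_alg u) = 0"
      using \<open>ev t = 0\<close> T[of "abs_free_alg t" "abs_free_alg u"] by (simp add: ev)
    then have "in_I (Mult t u)"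
      by (simp add: p_zero mem_J times_free_alg.abs_eq)
    moreover have "alg_class X Rel (Mult t u) = alg_class X Rel t"
      using u t by (simp add: alg_class_eq_iff)
    ultimately show "alg_class X Rel t \<in> I"
      using t u by (simp add: in_I_def restrict_gens_id)
  next
    assume "alg_class X Rel t \<in> I"
    then have "abs_free_alg t \<in> J"
      using t by (simp add: mem_J in_I_def restrict_gens_id)
    then show "ev t = 0"
      using J_mult by (intro endo_eqI) (simp add: ev T p_zero)
  qed
  have "ev s = ev t" if "(s, t) \<in> Rel" "s \<in> alg_terms X" "t \<in> alg_terms X" for s t
  proof -
    have "alg_cong Rel (Add s (Scale (- 1) t)) Zero"
      using that by (intro alg_cong_diff alg_cong.rel)
    then have "alg_class X Rel (Add s (Scale (- 1) t)) = alg_class X Rel Zero"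
      using that by (simp add: alg_class_eq_iff)
    then have "ev (Add s (Scale (- 1) t)) = 0"
      using that I_zero by (subst zero_iff) simp_all
    then show ?thesis
      by (simp add: sc_minus_one)
  qed
  with central zero_iff show thesis
    by (rule that)
qed

section \<open>Local units\<close>

declare alg_cong.trans [trans]

abbreviation vertex_sum :: "'v list \<Rightarrow> (('v, 'e) lpa_gen, 'k) alg_term" where
  "vertex_sum vs \<equiv> foldr (\<lambda>v t. Add (Gen (Vertex v)) t) vs Zero"

lemma vertex_sum_in_alg_terms: "set vs \<subseteq> verts E \<Longrightarrow> vertex_sum vs \<in> alg_terms (lpa_gens E)"
  by (induction vs) (auto simp: lpa_gens_def)

lemma alg_cong_vertex_vertex_sum:
  assumes "v \<in> verts E" "set vs \<subseteq> verts E" "distinct vs"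
  shows "alg_cong (lpa_rels E) (Mult (Gen (Vertex v)) (vertex_sum vs))
    (if v \<in> set vs then Gen (Vertex v) else Zero)"
  using assms(2,3)
proof (induction vs)
  case Nil
  then show ?case by (simp add: alg_cong_mult_zero)
next
  case (Cons w vs)
  let ?v = "Gen (Vertex v) :: (('a, 'b) lpa_gen, 'c) alg_term"
  let ?a = "if v = w then ?v else Zero" and ?b = "if v \<in> set vs then ?v else Zero"
  have 1: "alg_cong (lpa_rels E) (Mult ?v (Gen (Vertex w))) ?a"
    using Cons.prems assms(1) alg_cong.rel[OF lpa_rels.vertex_idem[of v E]]
      alg_cong.rel[OF lpa_rels.vertex_orth[of v E w]]
    by (cases "v = w") simp_all
  have "alg_cong (lpa_rels E) (Mult ?v (vertex_sum (w # vs)))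
      (Add (Mult ?v (Gen (Vertex w))) (Mult ?v (vertex_sum vs)))"
    by (simp add: alg_cong.mult_add_right)
  also have "alg_cong (lpa_rels E) \<dots> (Add ?a ?b)"
    using Cons by (intro alg_cong.add 1) auto
  also have "alg_cong (lpa_rels E) \<dots> (if v \<in> set (w # vs) then ?v else Zero)"
    using Cons.prems by (intro free_alg_eqD) (auto simp: abs_free_alg_simps)
  finally show ?case .
qed

text \<open>Finitely many vertices occur at the right ends of a term, and the sum of any finite set
  of vertices containing them is a right identity for it.\<close>

lemma lpa_right_unit:
  assumes "wf_digraph E" "t \<in> alg_terms (lpa_gens E)"
  shows "\<exists>u\<in>alg_terms (lpa_gens E). alg_cong (lpa_rels E :: (_, 'k::field) alg_term rel) (Mult t u) t"
proof -
  let ?R = "lpa_rels E :: (_, 'k) alg_term rel"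
  have wf: "head E e \<in> verts E" "tail E e \<in> verts E" if "e \<in> arcs E" for e
    using assms(1) that by (auto simp: wf_digraph_def)
  have via_vertex: "alg_cong ?R (Mult s (vertex_sum vs)) s"
    if "alg_cong ?R (Mult s (Gen (Vertex v))) s" "v \<in> set vs" "set vs \<subseteq> verts E" "distinct vs"
    for s v vs
  proof -
    have "alg_cong ?R (Mult s (vertex_sum vs)) (Mult (Mult s (Gen (Vertex v))) (vertex_sum vs))"
      by (intro alg_cong.mult alg_cong.sym[OF that(1)] alg_cong.refl)
    also
    have "alg_cong ?R \<dots> (Mult s (Mult (Gen (Vertex v)) (vertex_sum vs)))"
      by (rule alg_cong.mult_assoc)
    also have "alg_cong ?R \<dots> (Mult s (Gen (Vertex v)))"
      using alg_cong_vertex_vertex_sum[of v E vs] that by (intro alg_cong.mult alg_cong.refl) auto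
    also have "alg_cong ?R \<dots> s"
      by (fact that(1))
    finally show ?thesis .
  qed
  \<comment> \<open>Stated for all larger lists of vertices, so that the two summands of
    \<open>Add\<close> can share one unit.\<close>
  have "\<exists>S. finite S \<and> S \<subseteq> verts E \<and> (\<forall>vs. S \<subseteq> set vs \<and> set vs \<subseteq> verts E \<and> distinct vs \<longrightarrow>
      alg_cong ?R (Mult t (vertex_sum vs)) t)"
    using assms(2)
  proof (induction t)
    case (Gen x)
    then consider v where "x = Vertex v" "v \<in> verts E" | e where "x = Edge e" "e \<in> arcs E"
      | e where "x = Ghost e" "e \<in> arcs E"
      by (auto simp: lpa_gens_def)
    then obtain v where "v \<in> verts E" "alg_cong ?R (Mult (Gen x) (Gen (Vertex v))) (Gen x)"
    proof cases
      case 1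
      then show ?thesis
        by (intro that[of v]) (simp_all add: alg_cong.rel lpa_rels.vertex_idem)
    next
      case 2
      then show ?thesis
        by (intro that[of "head E e"]) (simp_all add: wf alg_cong.rel lpa_rels.edge_range)
    next
      case 3
      then show ?thesis
        by (intro that[of "tail E e"]) (simp_all add: wf alg_cong.rel lpa_rels.ghost_source)
    qed
    then show ?case
      by (intro exI[of _ "{v}"]) (simp add: via_vertex[of "Gen x" v])
  next
    case Zero
    have "alg_cong ?R (Mult Zero u) Zero" for u
      by (rule free_alg_eqD) (simp add: abs_free_alg_simps)
    then show ?case
      by (intro exI[of _ "{}"]) auto
  next
    case (Add s t)
    then obtain S T where "finite S" "S \<subseteq> verts E" "finite T" "T \<subseteq> verts E"
      and *: "\<And>vs. S \<subseteq> set vs \<Longrightarrow> set vs \<subseteq> verts E \<Longrightarrow> distinct vs \<Longrightarrow>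
          alg_cong ?R (Mult s (vertex_sum vs)) s"
        "\<And>vs. T \<subseteq> set vs \<Longrightarrow> set vs \<subseteq> verts E \<Longrightarrow> distinct vs \<Longrightarrow>
          alg_cong ?R (Mult t (vertex_sum vs)) t"
      by auto
    moreover have "alg_cong ?R (Mult (Add s t) (vertex_sum vs)) (Add s t)"
      if "S \<union> T \<subseteq> set vs" "set vs \<subseteq> verts E" "distinct vs" for vs
      using that by (intro alg_cong.trans[OF alg_cong.mult_add_left] alg_cong.add *) auto
    ultimately show ?case
      by (intro exI[of _ "S \<union> T"]) auto
  next
    case (Scale a t)
    then obtain S where "finite S" "S \<subseteq> verts E" and "\<And>vs. S \<subseteq> set vs \<Longrightarrow>
        set vs \<subseteq> verts E \<Longrightarrow> distinct vs \<Longrightarrow> alg_cong ?R (Mult t (vertex_sum vs)) t"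
      by auto
    then show ?case
      by (intro exI[of _ S])
        (simp add: alg_cong.trans[OF alg_cong.scale_mult_left alg_cong.scale])
  next
    case (Mult s t)
    then obtain S where "finite S" "S \<subseteq> verts E" and "\<And>vs. S \<subseteq> set vs \<Longrightarrow>
        set vs \<subseteq> verts E \<Longrightarrow> distinct vs \<Longrightarrow> alg_cong ?R (Mult t (vertex_sum vs)) t"
      by auto
    then show ?case
      by (intro exI[of _ S])
        (simp add: alg_cong.trans[OF alg_cong.mult_assoc alg_cong.mult[OF alg_cong.refl]])
  qed
  then obtain S where "finite S" "S \<subseteq> verts E" and *: "\<And>vs. S \<subseteq> set vs \<Longrightarrow>
      set vs \<subseteq> verts E \<Longrightarrow> distinct vs \<Longrightarrow> alg_cong ?R (Mult t (vertex_sum vs)) t"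
    by auto
  moreover from \<open>finite S\<close> obtain vs where "set vs = S" "distinct vs"
    using finite_distinct_list by blast
  ultimately show ?thesis
    using vertex_sum_in_alg_terms[of vs E] by (intro bexI[of _ "vertex_sum vs"]) auto
qed


section \<open>Closed paths under Condition (K)\<close>

context wf_digraph
begin

lemma closed_awalk_appendD:
  assumes "awalk w (p @ q) w'" "awalk w p u"
  shows "awalk u q w'"
  using assms by (auto simp: awalk_append_iff)

text \<open>An intermediate return to \<open>w\<close> yields a strictly shorter closed
  path.\<close>

lemma ex_simple_closed_path:
  assumes "awalk w p w" "p \<noteq> []"
  shows "\<exists>c. simple_closed_path G w c"
  using assms
proof (induction p rule: length_induct)
  case (1 p)
  show ?case
  proof (cases "\<forall>e\<in>set (tl p). tail G e \<noteq> w")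
    case True
    then show ?thesis
      using 1 by (auto simp: simple_closed_path_def)
  next
    case False
    then obtain e p1 p2 where e: "tl p = p1 @ e # p2" "tail G e = w"
      by (metis split_list)
    then have p: "p = (hd p # p1) @ (e # p2)"
      using 1(3) by (cases p) auto
    then obtain u where "awalk w (hd p # p1) u" "awalk u (e # p2) w"
      using 1(2) by (metis awalk_append_iff)
    moreover then have "u = w"
      using e by (auto simp: awalk_Cons_iff)
    moreover have "length (hd p # p1) < length p"
      by (subst (2) p) simp
    ultimately show ?thesis
      using 1(1) by blast
  qed
qed

text \<open>Otherwise the remaining part of \<open>c\<close> would leave \<open>w\<close> a second
  time. Consequently the simple closed paths at \<open>w\<close> form a prefix code, the property
  that drives \<open>not_prefix_shifted\<close>.\<close>

lemma closed_prefix_simple_closed_path: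
  assumes "simple_closed_path G w c" "awalk w p w" "p \<noteq> []" "prefix p c"
  shows "p = c"
proof (rule ccontr)
  assume "p \<noteq> c"
  with assms(4) obtain q' where "c = p @ q'" "q' \<noteq> []"
    by (auto simp: prefix_def)
  then obtain e q where c: "c = p @ e # q"
    by (cases q') auto
  then have "awalk w (e # q) w"
    using assms(1,2) closed_awalk_appendD[of w p "e # q" w w] by (simp add: simple_closed_path_def)
  then have "tail G e = w"
    by (auto simp: awalk_Cons_iff)
  moreover have "e \<in> set (tl c)"
    using c assms(3) by (cases p) auto
  ultimately show False
    using assms(1) by (auto simp: simple_closed_path_def)
qed

text \<open>Strip copies of \<open>c\<close> from both sides. By the prefix code property
  \<open>p\<close> must begin with \<open>c\<close>; removing that copy shortens \<open>p\<close>
  and costs a copy on the left only, which is why the exponents are separate. As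
  \<open>length p \<le> m\<close>, \<open>p\<close> is used up at a stage where the right side has
  more copies of \<open>c\<close> than the left, so \<open>c'\<close> would have to be comparable
  with \<open>c\<close>.\<close>

lemma not_prefix_shifted:
  assumes c: "simple_closed_path G w c" and c': "simple_closed_path G w c'" and "c \<noteq> c'"
    and "awalk w p w" "p \<noteq> []" "length p \<le> m" "m \<le> n"
  shows "\<not> prefix (concat (replicate m c) @ c') (p @ concat (replicate n c) @ c')"
  using assms(4-)
proof (induction m arbitrary: p)
  case (Suc m)
  let ?X = "concat (replicate m c) @ c'" and ?Y = "concat (replicate n c) @ c'"
  have cw: "awalk w c w" "c \<noteq> []" and cw': "awalk w c' w" "c' \<noteq> []"
    using c c' by (auto simp: simple_closed_path_def)
  have no_XY: "\<not> prefix ?X ?Y"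
  proof
    assume "prefix ?X ?Y"
    moreover have "?Y = concat (replicate m c) @ c @ concat (replicate (n - Suc m) c) @ c'"
    proof -
      have "n = m + Suc (n - Suc m)"
        using Suc.prems(4) by simp
      then have "replicate n c = replicate m c @ replicate (Suc (n - Suc m)) c"
        by (metis replicate_add)
      then show ?thesis
        by simp
    qed
    ultimately have "prefix c' (c @ concat (replicate (n - Suc m) c) @ c')"
      by simp
    then have "prefix c' c \<or> prefix c c'"
      by (metis prefixI prefix_same_cases)
    then show False
      using closed_prefix_simple_closed_path[OF c cw'] closed_prefix_simple_closed_path[OF c' cw]
        \<open>c \<noteq> c'\<close> by auto
  qed
  show ?case
  proof
    assume "prefix (concat (replicate (Suc m) c) @ c') (p @ ?Y)"
    then have *: "prefix (c @ ?X) (p @ ?Y)"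
      by simp
    then have "prefix c (p @ ?Y)"
      using append_prefixD by blast
    then have "prefix c p \<or> prefix p c"
      by (metis prefixI prefix_same_cases)
    then obtain p' where p: "p = c @ p'"
      using closed_prefix_simple_closed_path[OF c Suc.prems(1,2)] by (metis append_Nil2 prefixE)
    then have X: "prefix ?X (p' @ ?Y)"
      using * by simp
    show False
    proof (cases "p' = []")
      case True
      then show False
        using X no_XY by simp
    next
      case False
      have "awalk w p' w"
        using Suc.prems(1) p cw closed_awalk_appendD by blast
      moreover have "length p' \<le> m"
        using Suc.prems(3) p cw(2) by (cases c) auto
      ultimately show False
        using Suc.IH[of p'] X False Suc.prems(4) by simp
    qed
  qed
qed simp

lemma awalk_concat_replicate:
  "awalk w c w \<Longrightarrow> awalk w (concat (replicate m c)) w"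
  by (induction m) (auto simp: awalk_Nil_iff awalk_hd_in_verts)

text \<open>With \<open>m\<close> bounding the lengths in \<open>N\<close>, the path
  \<open>c^m c'\<close> works. It serves for conjugation: the ghost of \<open>q\<close> annihilates
  \<open>p q\<close> when neither is a prefix of the other.\<close>

lemma condition_K_separating_path:
  assumes K: "condition_K G" and w: "w \<in> verts G" and "finite N"
  obtains q where "awalk w q w"
    "\<And>p. p \<in> N \<Longrightarrow> awalk w p w \<Longrightarrow> p \<noteq> [] \<Longrightarrow> \<not> prefix q (p @ q)"
proof (cases "\<exists>p. awalk w p w \<and> p \<noteq> []")
  case False
  then show ?thesis
    using that[of "[]"] w by (auto simp: awalk_Nil_iff)
next
  case True
  then obtain c c' where c: "simple_closed_path G w c" "simple_closed_path G w c'" "c \<noteq> c'"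
    using ex_simple_closed_path K w unfolding condition_K_def by metis
  then have cw: "awalk w c w" "awalk w c' w"
    by (auto simp: simple_closed_path_def)
  obtain m where m: "length p \<le> m" if "p \<in> N" for p
    using \<open>finite N\<close> finite_nat_set_iff_bounded_le[of "length ` N"] by auto
  show ?thesis
  proof (rule that[of "concat (replicate m c) @ c'"])
    show "awalk w (concat (replicate m c) @ c') w"
      using awalk_concat_replicate[OF cw(1)] cw(2) by (rule awalk_appendI)
  qed (use not_prefix_shifted[OF c] m in auto)
qed

end

section \<open>Products of paths\<close>

text \<open>Instantiated twice: by the representation of \<open>L\<close> modulo an ideal and by the
  module over the dual numbers. The images of the generators are allowed to be zero.\<close>

locale leavitt_family = wf_digraph E + central_scalars sc \<rho>
  for E :: "('v, 'e) pre_digraph"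
    and sc :: "'k::field \<Rightarrow> 'a::{ring, monoid_mult}" and \<rho> :: "('v, 'e) lpa_gen \<Rightarrow> 'a" +
  assumes ev_rels: "(s, t) \<in> lpa_rels E \<Longrightarrow> ev s = ev t"
begin

abbreviation V :: "'v \<Rightarrow> 'a" where "V v \<equiv> \<rho> (Vertex v)"
abbreviation ed :: "'e \<Rightarrow> 'a" where "ed e \<equiv> \<rho> (Edge e)"
abbreviation gh :: "'e \<Rightarrow> 'a" where "gh e \<equiv> \<rho> (Ghost e)"

lemma V_V: "v \<in> verts E \<Longrightarrow> w \<in> verts E \<Longrightarrow> V v * V w = (if v = w then V v else 0)"
  using ev_rels[OF lpa_rels.vertex_idem[of v E]] ev_rels[OF lpa_rels.vertex_orth[of v E w]]
  by (cases "v = w") simp_all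

lemma V_ed: "v \<in> verts E \<Longrightarrow> e \<in> arcs E \<Longrightarrow> V v * ed e = (if v = tail E e then ed e else 0)"
  using ev_rels[OF lpa_rels.source_edge[of e E]] V_V[of v "tail E e"]
  by simp (metis mult.assoc mult_zero_left)

lemma ed_V: "v \<in> verts E \<Longrightarrow> e \<in> arcs E \<Longrightarrow> ed e * V v = (if v = head E e then ed e else 0)"
  using ev_rels[OF lpa_rels.edge_range[of e E]] V_V[of "head E e" v]
  by simp (metis mult.assoc mult_zero_right)

lemma V_gh: "v \<in> verts E \<Longrightarrow> e \<in> arcs E \<Longrightarrow> V v * gh e = (if v = head E e then gh e else 0)"
  using ev_rels[OF lpa_rels.range_ghost[of e E]] V_V[of v "head E e"]
  by simp (metis mult.assoc mult_zero_left)

lemma gh_V: "v \<in> verts E \<Longrightarrow> e \<in> arcs E \<Longrightarrow> gh e * V v = (if v = tail E e then gh e else 0)"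
  using ev_rels[OF lpa_rels.ghost_source[of e E]] V_V[of "tail E e" v]
  by simp (metis mult.assoc mult_zero_right)

lemma gh_ed: "e \<in> arcs E \<Longrightarrow> f \<in> arcs E \<Longrightarrow> gh e * ed f = (if e = f then V (head E e) else 0)"
  using ev_rels[OF lpa_rels.ghost_edge_same[of e E]] ev_rels[OF lpa_rels.ghost_edge_diff[of e E f]]
  by (cases "e = f") simp_all

text \<open>The vertex argument gives a value to the empty path; a nonempty list determines its
  start by its first edge.\<close>

primrec path :: "'v \<Rightarrow> 'e list \<Rightarrow> 'a" where
  "path v [] = V v"
| "path v (e # es) = ed e * path (head E e) es"

primrec ghost_path :: "'v \<Rightarrow> 'e list \<Rightarrow> 'a" where
  "ghost_path v [] = V v"
| "ghost_path v (e # es) = ghost_path (head E e) es * gh e"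

lemma V_path:
  assumes "u \<in> verts E" "awalk v p w"
  shows "V u * path v p = (if u = v then path v p else 0)"
proof (cases p)
  case Nil
  then show ?thesis
    using assms by (auto simp: V_V awalk_simps)
next
  case (Cons e es)
  then show ?thesis
    using assms V_ed[of u e] by (auto simp: awalk_simps mult.assoc[symmetric])
qed

lemma path_V:
  assumes "u \<in> verts E" "awalk v p w"
  shows "path v p * V u = (if u = w then path v p else 0)"
  using assms(2) by (induction p arbitrary: v) (auto simp: awalk_simps V_V assms(1) mult.assoc)

lemma ghost_path_V:
  assumes "u \<in> verts E" "awalk v p w"
  shows "ghost_path v p * V u = (if u = v then ghost_path v p else 0)"
proof (cases p)
  case Nil
  then show ?thesis
    using assms by (auto simp: V_V awalk_simps)
next
  case (Cons e es)
  then show ?thesis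
    using assms gh_V[of u e] by (auto simp: awalk_simps mult.assoc)
qed

lemma path_append:
  assumes "awalk v p u" "awalk u q w"
  shows "path v (p @ q) = path v p * path u q"
  using assms
proof (induction p arbitrary: v)
  case Nil
  then show ?case
    using V_path[of u u q w] by (auto simp: awalk_simps)
qed (auto simp: awalk_simps mult.assoc)

lemma ghost_path_path:
  assumes "awalk v p w" "awalk w q u"
  shows "ghost_path v p * path v (p @ q) = path w q"
  using assms
proof (induction p arbitrary: v)
  case Nil
  then show ?case
    using V_path[of w w q u] by (auto simp: awalk_simps)
next
  case (Cons e p)
  let ?h = "head E e"
  have e: "e \<in> arcs E" and p: "awalk ?h p w"
    using Cons.prems by (auto simp: awalk_simps)
  have "ghost_path v (e # p) * path v ((e # p) @ q)
      = ghost_path ?h p * ((gh e * ed e) * path ?h (p @ q))"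
    by (simp add: mult.assoc)
  also have "\<dots> = (ghost_path ?h p * V ?h) * path ?h (p @ q)"
    using e by (simp add: gh_ed mult.assoc)
  also have "\<dots> = ghost_path ?h p * path ?h (p @ q)"
    using p e by (simp add: ghost_path_V)
  finally show ?case
    using Cons.IH[OF p Cons.prems(2)] by simp
qed

lemma ghost_path_path_same: "awalk v p w \<Longrightarrow> ghost_path v p * path v p = V w"
  using ghost_path_path[of v p w "[]" w] by (simp add: awalk_simps awalk_last_in_verts)

lemma ghost_path_path_vertex_diff:
  assumes "awalk v p w" "awalk u q w'" "u \<noteq> v"
  shows "ghost_path v p * path u q = 0"
proof -
  have "ghost_path v p * path u q = ghost_path v p * (V v * path u q)"
    using ghost_path_V[of v v p w] assms by (auto simp: mult.assoc[symmetric])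
  then show ?thesis
    using V_path[of v u q w'] assms by auto
qed

text \<open>Incomparable paths have a first pair of different edges; everything before it cancels,
  and there \<open>e* f = 0\<close> applies.\<close>

lemma ghost_path_path_diff:
  assumes "awalk v p w" "awalk v q w'" "\<not> prefix p q" "\<not> prefix q p"
  shows "ghost_path v p * path v q = 0"
  using assms
proof (induction p arbitrary: v q)
  case (Cons e p)
  then obtain f q' where q: "q = f # q'"
    by (cases q) auto
  have ef: "e \<in> arcs E" "f \<in> arcs E" and p: "awalk (head E e) p w" "awalk (head E f) q' w'"
    using Cons.prems q by (auto simp: awalk_simps)
  have *: "ghost_path v (e # p) * path v q
      = ghost_path (head E e) p * ((gh e * ed f) * path (head E f) q')"
    by (simp add: q mult.assoc)
  show ?case
  proof (cases "e = f")
    case True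
    then have "ghost_path v (e # p) * path v q
        = (ghost_path (head E e) p * V (head E e)) * path (head E e) q'"
      using ef * by (simp add: gh_ed mult.assoc)
    also have "\<dots> = ghost_path (head E e) p * path (head E e) q'"
      using p ef by (simp add: ghost_path_V)
    also have "\<dots> = 0"
      using Cons.IH[OF p(1)] p(2) Cons.prems(3,4) True q by simp
    finally show ?thesis .
  next
    case False
    then show ?thesis
      using ef * by (simp add: gh_ed)
  qed
qed simp

end


section \<open>Reduction to idempotents\<close>

context leavitt_family
begin

lemma head_tail_in_verts: "e \<in> arcs E \<Longrightarrow> head E e \<in> verts E" "e \<in> arcs E \<Longrightarrow> tail E e \<in> verts E"
  by simp_all

lemma path_single: "e \<in> arcs E \<Longrightarrow> path v [e] = ed e"
  by (simp add: ed_V head_tail_in_verts)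

lemma ghost_path_single: "e \<in> arcs E \<Longrightarrow> ghost_path v [e] = gh e"
  by (simp add: V_gh head_tail_in_verts)

lemma ghost_path_append:
  assumes "awalk v p u" "awalk u q w"
  shows "ghost_path v (p @ q) = ghost_path u q * ghost_path v p"
  using assms
proof (induction p arbitrary: v)
  case Nil
  then show ?case
    using ghost_path_V[of u u q w] by (auto simp: awalk_simps)
qed (auto simp: awalk_simps mult.assoc)

text \<open>The target ring is larger than the image of \<open>L\<close>. Multipliers have to come
  from this image in order to be lifted back to \<open>L\<close>.\<close>

definition subalg :: "'a set" where
  "subalg = ev ` alg_terms (lpa_gens E)"

lemma subalg_gen: "x \<in> lpa_gens E \<Longrightarrow> \<rho> x \<in> subalg"
  unfolding subalg_def by (rule image_eqI[of _ _ "Gen x"]) simp_all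

lemma subalg_V: "v \<in> verts E \<Longrightarrow> V v \<in> subalg"
  and subalg_ed: "e \<in> arcs E \<Longrightarrow> ed e \<in> subalg"
  and subalg_gh: "e \<in> arcs E \<Longrightarrow> gh e \<in> subalg"
  by (simp_all add: subalg_gen lpa_gens_def)

lemma subalg_mult:
  assumes "a \<in> subalg" "b \<in> subalg"
  shows "a * b \<in> subalg"
proof -
  obtain s t where "s \<in> alg_terms (lpa_gens E)" "t \<in> alg_terms (lpa_gens E)" "a = ev s" "b = ev t"
    using assms by (auto simp: subalg_def)
  then show ?thesis
    unfolding subalg_def by (intro image_eqI[of _ _ "Mult s t"]) simp_all
qed

lemma subalg_scale:
  assumes "a \<in> subalg"
  shows "sc k * a \<in> subalg"
proof -
  obtain t where "t \<in> alg_terms (lpa_gens E)" "a = ev t"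
    using assms by (auto simp: subalg_def)
  then show ?thesis
    unfolding subalg_def by (intro image_eqI[of _ _ "Scale k t"]) simp_all
qed

lemma subalg_sc:
  assumes "x \<in> subalg"
  shows "x * (sc k * y) = sc k * (x * y)"
  using assms unfolding subalg_def by (auto simp: mult.assoc[symmetric] sc_ev)

lemma subalg_diff:
  assumes "a \<in> subalg" "b \<in> subalg"
  shows "a - b \<in> subalg"
proof -
  obtain s t where "s \<in> alg_terms (lpa_gens E)" "t \<in> alg_terms (lpa_gens E)" "a = ev s" "b = ev t"
    using assms by (auto simp: subalg_def)
  then show ?thesis
    unfolding subalg_def
    by (intro image_eqI[of _ _ "Add s (Scale (- 1) t)"]) (simp_all add: sc_minus_one)
qed

lemma subalg_path: "awalk v p w \<Longrightarrow> path v p \<in> subalg"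
  by (induction p arbitrary: v) (auto simp: awalk_simps subalg_V subalg_ed subalg_mult)

lemma subalg_ghost_path: "awalk v p w \<Longrightarrow> ghost_path v p \<in> subalg"
  by (induction p arbitrary: v) (auto simp: awalk_simps subalg_V subalg_gh subalg_mult)

section \<open>Spanning by products of a real path and a ghost path\<close>

text \<open>The ghost degree \<open>n\<close> is the induction parameter of the reduction theorem.\<close>

inductive_set mono_span :: "nat \<Rightarrow> 'a set" for n where
  zero: "0 \<in> mono_span n"
| add: "a \<in> mono_span n \<Longrightarrow> awalk v p u \<Longrightarrow> awalk w q u \<Longrightarrow> length q \<le> n \<Longrightarrow>
    a + sc k * (path v p * ghost_path w q) \<in> mono_span n"

lemma mono_span_add: "b \<in> mono_span n \<Longrightarrow> a \<in> mono_span n \<Longrightarrow> a + b \<in> mono_span n"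
  by (induction rule: mono_span.induct) (auto simp: add.assoc[symmetric] intro: mono_span.add)

lemma mono_span_monomial:
  "awalk v p u \<Longrightarrow> awalk w q u \<Longrightarrow> length q \<le> n \<Longrightarrow> sc k * (path v p * ghost_path w q) \<in> mono_span n"
  using mono_span.add[OF mono_span.zero] by simp

lemma mono_span_mono: "a \<in> mono_span n \<Longrightarrow> n \<le> m \<Longrightarrow> a \<in> mono_span m"
  by (induction rule: mono_span.induct) (auto intro: mono_span.intros)

lemma mono_span_scale:
  assumes "a \<in> mono_span n"
  shows "sc k * a \<in> mono_span n"
  using assms
proof induction
  case (add a v p u w q l)
  then show ?case
    using mono_span.add[of "sc k * a" n v p u w q "k * l"]
    by (simp add: distrib_left sc_mult mult.assoc)
qed (simp add: mono_span.zero)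

text \<open>The ghost part grows only when a ghost edge meets an empty real part; in all other cases
  the generator changes or annihilates the real part.\<close>

lemma gen_monomial:
  assumes x: "x \<in> lpa_gens E" and p: "awalk v p u" and q: "awalk w q u"
  obtains "\<rho> x * (path v p * ghost_path w q) = 0"
  | v' p' u' q' where "awalk v' p' u'" "awalk w q' u'" "length q' \<le> Suc (length q)"
    "\<rho> x * (path v p * ghost_path w q) = path v' p' * ghost_path w q'"
proof -
  consider y where "x = Vertex y" "y \<in> verts E" | e where "x = Edge e" "e \<in> arcs E"
    | e where "x = Ghost e" "e \<in> arcs E"
    using x by (auto simp: lpa_gens_def)
  then show thesis
  proof cases
    case 1
    then have "\<rho> x * (path v p * ghost_path w q) = (if y = v then path v p else 0) * ghost_path w q"
      using V_path[OF _ p] by (simp add: mult.assoc[symmetric])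
    then show thesis
      using that(1) that(2)[OF p q] by (cases "y = v") simp_all
  next
    case 2
    have *: "\<rho> x * (path v p * ghost_path w q) = ed e * (V (head E e) * path v p) * ghost_path w q"
      using 2 by (simp add: ed_V head_tail_in_verts mult.assoc[symmetric])
    show thesis
    proof (cases "head E e = v")
      case True
      then have "\<rho> x * (path v p * ghost_path w q) = path (tail E e) (e # p) * ghost_path w q"
        using * V_path[OF _ p, of v] 2 head_tail_in_verts by auto
      then show thesis
        using that(2)[of "tail E e" "e # p" u q] True p q 2 by (simp add: awalk_simps)
    next
      case False
      then show thesis
        using that(1) * V_path[OF _ p, of "head E e"] 2 by (simp add: head_tail_in_verts)
    qed
  next
    case 3
    show thesis
    proof (cases p)
      case Nil
      then have u: "u = v" "v \<in> verts E"
        using p by (auto simp: awalk_simps)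
      have "\<rho> x * (path v p * ghost_path w q) = (if v = tail E e then gh e * ghost_path w q else 0)"
        using Nil 3 u gh_V[of v e] by (simp add: mult.assoc[symmetric])
      moreover have "gh e * ghost_path w q = path (head E e) [] * ghost_path w (q @ [e])"
        and "awalk w (q @ [e]) (head E e)" if "v = tail E e"
      proof -
        have e: "awalk u [e] (head E e)"
          using that u 3 by (simp add: awalk_simps head_tail_in_verts)
        then show "awalk w (q @ [e]) (head E e)"
          using q by (rule awalk_appendI[rotated])
        have "ghost_path w (q @ [e]) = gh e * ghost_path w q"
          using ghost_path_append[OF q e] 3 by (simp only: ghost_path_single)
        then show "gh e * ghost_path w q = path (head E e) [] * ghost_path w (q @ [e])"
          using 3 by (simp add: V_gh head_tail_in_verts mult.assoc[symmetric])
      qed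
      moreover have "awalk (head E e) [] (head E e)"
        using 3 by (simp add: awalk_Nil_iff)
      ultimately show thesis
        using that(1) that(2)[of "head E e" "[]" "head E e" "q @ [e]"]
        by (cases "v = tail E e") (simp_all del: path.simps awalk_append_iff)
    next
      case (Cons f p')
      then have f: "f \<in> arcs E" "awalk (head E f) p' u"
        using p by (auto simp: awalk_simps)
      have "\<rho> x * (path v p * ghost_path w q) = (gh e * ed f) * path (head E f) p' * ghost_path w q"
        using Cons 3 by (simp add: mult.assoc)
      then have "\<rho> x * (path v p * ghost_path w q)
          = (if e = f then path (head E f) p' else 0) * ghost_path w q"
        using 3 f V_path[OF _ f(2)] by (simp add: gh_ed head_tail_in_verts)
      then show thesis
        using that(1) that(2)[OF f(2) q] by (cases "e = f") simp_all
    qed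
  qed
qed

lemma gen_mono_span:
  assumes "x \<in> lpa_gens E" "a \<in> mono_span n"
  shows "\<rho> x * a \<in> mono_span (Suc n)"
  using assms(2)
proof induction
  case (add a v p u w q k)
  have *: "\<rho> x * (sc k * (path v p * ghost_path w q)) = sc k * (\<rho> x * (path v p * ghost_path w q))"
    by (metis mult.assoc sc_gen)
  have "sc k * (\<rho> x * (path v p * ghost_path w q)) \<in> mono_span (Suc n)"
    using assms(1) add.hyps(2,3)
    by (cases rule: gen_monomial) (use add.hyps(4) in \<open>auto simp: mono_span.zero mono_span_monomial\<close>)
  then show ?case
    using add.IH by (simp add: distrib_left mono_span_add *)
qed (simp add: mono_span.zero)

lemma ev_mult_mono_span:
  assumes "t \<in> alg_terms (lpa_gens E)" "a \<in> mono_span n"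
  shows "\<exists>m. ev t * a \<in> mono_span m"
  using assms
proof (induction t arbitrary: a n)
  case (Gen x)
  then show ?case
    using gen_mono_span by auto
next
  case (Add s t)
  then obtain m m' where "ev s * a \<in> mono_span m" "ev t * a \<in> mono_span m'"
    by (metis alg_terms_simps(3))
  then have "ev s * a \<in> mono_span (max m m')" "ev t * a \<in> mono_span (max m m')"
    by (auto intro: mono_span_mono)
  then show ?case
    by (auto simp: distrib_right intro: mono_span_add)
next
  case (Scale k t)
  then obtain m where "ev t * a \<in> mono_span m"
    by auto
  then show ?case
    using mono_span_scale by (auto simp: mult.assoc)
next
  case (Mult s t)
  then have "s \<in> alg_terms (lpa_gens E)"
    by simp
  moreover obtain m where "ev t * a \<in> mono_span m"
    using Mult.IH(2)[OF _ Mult.prems(2)] Mult.prems(1) by auto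
  ultimately obtain m' where "ev s * (ev t * a) \<in> mono_span m'"
    using Mult.IH(1) by blast
  then show ?case
    by (auto simp: mult.assoc)
qed (auto intro: mono_span.zero)

text \<open>The spans contain the generators, and left multiplication by a term leads from one span
  into another.\<close>

lemma subalg_mono_span:
  assumes "a \<in> subalg"
  shows "\<exists>n. a \<in> mono_span n"
proof -
  have "\<exists>n. ev t \<in> mono_span n" if "t \<in> alg_terms (lpa_gens E)" for t
    using that
  proof (induction t)
    case (Gen x)
    then consider y where "x = Vertex y" "y \<in> verts E" | e where "x = Edge e" "e \<in> arcs E"
      | e where "x = Ghost e" "e \<in> arcs E"
      by (auto simp: lpa_gens_def)
    then show ?case
    proof cases
      case 1
      then show ?thesis
        using mono_span_monomial[of y "[]" y y "[]" 0 1]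
        by (auto simp: sc_one V_V awalk_simps)
    next
      case 2
      then show ?thesis
        using mono_span_monomial[of "tail E e" "[e]" "head E e" "head E e" "[]" 0 1]
        by (auto simp: sc_one ed_V head_tail_in_verts awalk_simps)
    next
      case 3
      then show ?thesis
        using mono_span_monomial[of "head E e" "[]" "head E e" "tail E e" "[e]" 1 1]
        by (auto simp: sc_one V_gh head_tail_in_verts awalk_simps)
    qed
  next
    case (Add s t)
    then obtain m m' where "ev s \<in> mono_span m" "ev t \<in> mono_span m'"
      by auto
    then have "ev s \<in> mono_span (max m m')" "ev t \<in> mono_span (max m m')"
      by (auto intro: mono_span_mono)
    then show ?case
      by (auto intro: mono_span_add)
  next
    case (Mult s t)
    then show ?case
      using ev_mult_mono_span by auto
  qed (auto intro: mono_span.zero mono_span_scale)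
  then show ?thesis
    using assms by (auto simp: subalg_def)
qed

text \<open>Right multiplication by a vertex selects the monomials whose \<open>w\<close> is that
  vertex, and only finitely many \<open>w\<close> occur.\<close>

lemma mono_span_right_unit:
  assumes "a \<in> mono_span n"
  shows "\<exists>S. finite S \<and> S \<subseteq> verts E \<and>
    (\<forall>T. finite T \<and> S \<subseteq> T \<and> T \<subseteq> verts E \<longrightarrow> (\<Sum>v\<in>T. a * V v) = a)"
  using assms
proof induction
  case (add a v p u w q k)
  obtain S where S: "finite S" "S \<subseteq> verts E"
    "\<And>T. finite T \<Longrightarrow> S \<subseteq> T \<Longrightarrow> T \<subseteq> verts E \<Longrightarrow> (\<Sum>v\<in>T. a * V v) = a"
    using add.IH by auto
  have w: "w \<in> verts E"
    using add.hyps(3) by (rule awalk_hd_in_verts)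
  let ?m = "sc k * (path v p * ghost_path w q)"
  have "(\<Sum>v\<in>T. (a + ?m) * V v) = a + ?m"
    if "finite T" "insert w S \<subseteq> T" "T \<subseteq> verts E" for T
  proof -
    have "(\<Sum>v\<in>T. ?m * V v) = (\<Sum>v\<in>T. if v = w then ?m else 0)"
      using that ghost_path_V[OF _ add.hyps(3)]
      by (intro sum.cong) (auto simp: mult.assoc)
    also have "\<dots> = ?m"
      using that by simp
    finally show ?thesis
      using that S(3)[of T] by (simp add: distrib_right sum.distrib)
  qed
  then show ?case
    using S w by (intro exI[of _ "insert w S"]) auto
qed (auto intro: exI[of _ "{}"])

lemma mono_span_V_nonzero:
  assumes "a \<in> mono_span n" "a \<noteq> 0"
  obtains v where "v \<in> verts E" "a * V v \<noteq> 0"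
proof -
  obtain S where "finite S" "S \<subseteq> verts E" "(\<Sum>v\<in>S. a * V v) = a"
    using mono_span_right_unit[OF assms(1)] by blast
  then show thesis
    using assms(2) that sum.neutral[of S "\<lambda>v. a * V v"] by (metis subsetD)
qed

text \<open>The last factor of a ghost part is the ghost of the first edge of \<open>q\<close>;
  \<open>e\<close> cancels it or annihilates the monomial. With empty \<open>q\<close>,
  \<open>e\<close> lengthens the real path or annihilates it.\<close>

lemma mono_span_ed:
  assumes "a \<in> mono_span (Suc n)" "e \<in> arcs E"
  shows "a * ed e \<in> mono_span n"
  using assms(1)
proof induction
  case (add a v p u w q k)
  let ?m = "path v p * ghost_path w q"
  have "sc k * (?m * ed e) \<in> mono_span n"
  proof (cases q)
    case Nil
    then have u: "u = w" "w \<in> verts E"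
      using add.hyps by (auto simp: awalk_simps)
    have m: "?m * ed e = (if w = tail E e then path v p * ed e else 0)"
      using Nil u V_ed[of w e] assms(2) by (simp add: mult.assoc)
    show ?thesis
    proof (cases "w = tail E e")
      case True
      have e: "awalk u [e] (head E e)"
        using True u assms(2) by (simp add: awalk_simps head_tail_in_verts)
      have "path v (p @ [e]) = path v p * ed e"
        using path_append[OF add.hyps(2) e] assms(2) by (simp only: path_single)
      then have "?m * ed e = path v (p @ [e]) * ghost_path (head E e) []"
        using m True ed_V[of "head E e" e] assms(2) by (simp add: head_tail_in_verts mult.assoc)
      then show ?thesis
        using mono_span_monomial[OF awalk_appendI[OF add.hyps(2) e], of "head E e" "[]" n k] assms(2)
        by (simp del: ghost_path.simps add: awalk_Nil_iff)
    qed (simp add: m mono_span.zero)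
  next
    case (Cons f q')
    then have f: "f \<in> arcs E" "awalk (head E f) q' u"
      using add.hyps by (auto simp: awalk_simps)
    have "?m * ed e = path v p * (ghost_path (head E f) q' * (gh f * ed e))"
      by (simp add: Cons mult.assoc)
    also have "\<dots> = (if f = e then path v p * ghost_path (head E f) q' else 0)"
      using f assms(2) ghost_path_V[OF _ f(2), of "head E f"] by (auto simp: gh_ed head_tail_in_verts)
    finally show ?thesis
      using add.hyps f Cons by (auto intro: mono_span_monomial mono_span.zero)
  qed
  then show ?case
    using add.IH by (simp add: distrib_right mult.assoc mono_span_add)
qed (simp add: mono_span.zero)

definition gap :: "'v \<Rightarrow> 'e set \<Rightarrow> 'a" where
  "gap v F = V v - (\<Sum>e\<in>F. ed e * gh e)"

lemma gap_ed:
  assumes "finite F" "F \<subseteq> out_arcs E v" "e \<in> out_arcs E v"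
  shows "gap v F * ed e = (if e \<in> F then 0 else ed e)"
proof -
  have e: "e \<in> arcs E" "tail E e = v"
    using assms(3) by auto
  have "(\<Sum>f\<in>F. ed f * gh f * ed e) = (\<Sum>f\<in>F. if f = e then ed e else 0)"
    using assms e
    by (intro sum.cong) (auto simp: mult.assoc gh_ed ed_V head_tail_in_verts)
  also have "\<dots> = (if e \<in> F then ed e else 0)"
    using assms by simp
  finally show ?thesis
    using e V_ed[of v e] head_tail_in_verts(2)[of e]
    by (simp add: gap_def left_diff_distrib sum_distrib_right)
qed

lemma gh_gap:
  assumes "finite F" "F \<subseteq> out_arcs E v" "e \<in> out_arcs E v"
  shows "gh e * gap v F = (if e \<in> F then 0 else gh e)"
proof -
  have e: "e \<in> arcs E" "tail E e = v"
    using assms(3) by auto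
  have "(\<Sum>f\<in>F. gh e * (ed f * gh f)) = (\<Sum>f\<in>F. if f = e then gh e else 0)"
    using assms e
    by (intro sum.cong) (auto simp: mult.assoc[symmetric] gh_ed V_gh head_tail_in_verts)
  also have "\<dots> = (if e \<in> F then gh e else 0)"
    using assms by simp
  finally show ?thesis
    using e gh_V[of v e] head_tail_in_verts(2)[of e]
    by (simp add: gap_def right_diff_distrib sum_distrib_left)
qed

lemma V_gap:
  assumes "finite F" "F \<subseteq> out_arcs E v" "v \<in> verts E" "u \<in> verts E"
  shows "V u * gap v F = (if u = v then gap v F else 0)"
proof -
  have "(\<Sum>f\<in>F. V u * (ed f * gh f)) = (\<Sum>f\<in>F. if u = v then ed f * gh f else 0)"
    using assms by (intro sum.cong) (auto simp: mult.assoc[symmetric] V_ed)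
  then show ?thesis
    using assms by (simp add: gap_def right_diff_distrib sum_distrib_left V_V)
qed

lemma gap_V:
  assumes "finite F" "F \<subseteq> out_arcs E v" "v \<in> verts E"
  shows "gap v F * V v = gap v F"
proof -
  have "(\<Sum>f\<in>F. ed f * gh f * V v) = (\<Sum>f\<in>F. ed f * gh f)"
    using assms by (intro sum.cong) (auto simp: mult.assoc gh_V)
  then show ?thesis
    using assms by (simp add: gap_def left_diff_distrib sum_distrib_right V_V)
qed

lemma gap_idem:
  assumes "finite F" "F \<subseteq> out_arcs E v" "v \<in> verts E"
  shows "gap v F * gap v F = gap v F"
proof -
  have "(\<Sum>f\<in>F. gap v F * (ed f * gh f)) = 0"
    using gap_ed[OF assms(1,2)] assms(2)
    by (intro sum.neutral) (auto simp: mult.assoc[symmetric] subset_iff)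
  moreover have "gap v F * gap v F = gap v F * V v - (\<Sum>f\<in>F. gap v F * (ed f * gh f))"
    by (simp add: gap_def[of v F] right_diff_distrib sum_distrib_left)
  ultimately show ?thesis
    using assms by (simp add: gap_V)
qed

lemma subalg_gap:
  assumes "finite F" "F \<subseteq> arcs E" "v \<in> verts E"
  shows "gap v F \<in> subalg"
  using assms(1,2)
proof induction
  case (insert e F)
  moreover have "gap v (insert e F) = gap v F - ed e * gh e"
    using insert by (simp add: gap_def algebra_simps)
  ultimately show ?case
    by (simp add: subalg_diff subalg_mult subalg_ed subalg_gh)
qed (simp add: gap_def subalg_V assms)

text \<open>An explicit index set, with one coefficient for each pair of start and edge list,
  instead of an inductive span: no path occurs twice, so a shortest path with nonzero coefficient
  can be selected without cancellation.\<close>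

definition path_span :: "'v \<Rightarrow> 'a set" where
  "path_span w = {\<Sum>i\<in>S. sc (k i) * path (fst i) (snd i) | S k.
     finite S \<and> (\<forall>i\<in>S. awalk (fst i) (snd i) w)}"

lemma path_span_zero: "0 \<in> path_span w"
  unfolding path_span_def by (auto intro: exI[of _ "{}"])

lemma path_span_add:
  assumes "b \<in> path_span w" "awalk v p w"
  shows "b + sc l * path v p \<in> path_span w"
proof -
  obtain S k where S: "finite S" "\<forall>i\<in>S. awalk (fst i) (snd i) w"
    and b: "b = (\<Sum>i\<in>S. sc (k i) * path (fst i) (snd i))"
    using assms(1) by (auto simp: path_span_def)
  \<comment> \<open>\<open>k\<close> is arbitrary outside \<open>S\<close>; resetting it to zero
    there lets one formula cover both a new path and a path already in \<open>S\<close>.\<close>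
  define k0 where "k0 i = (if i \<in> S then k i else 0)" for i
  define k' where "k' = k0((v, p) := k0 (v, p) + l)"
  have "(\<Sum>i\<in>insert (v, p) S. sc (k0 i) * path (fst i) (snd i)) = b"
    unfolding b using S(1) by (intro sum.mono_neutral_cong_right) (auto simp: k0_def)
  moreover have "(\<Sum>i\<in>insert (v, p) S. sc (k' i) * path (fst i) (snd i))
      = (\<Sum>i\<in>insert (v, p) S. sc (k0 i) * path (fst i) (snd i)
          + (if i = (v, p) then sc l * path v p else 0))"
    by (intro sum.cong) (auto simp: k'_def sc_add distrib_right)
  ultimately have "(\<Sum>i\<in>insert (v, p) S. sc (k' i) * path (fst i) (snd i)) = b + sc l * path v p"
    using S(1) by (simp add: sum.distrib)
  then show ?thesis
    unfolding path_span_def using S assms(2)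
    by (intro CollectI exI[of _ "insert (v, p) S"] exI[of _ k']) auto
qed

lemma path_span_V:
  assumes "b \<in> path_span w" "w \<in> verts E"
  shows "b * V w = b"
proof -
  obtain S k where S: "finite S" "\<forall>i\<in>S. awalk (fst i) (snd i) w"
    and b: "b = (\<Sum>i\<in>S. sc (k i) * path (fst i) (snd i))"
    using assms(1) by (auto simp: path_span_def)
  then show ?thesis
    using path_V[OF assms(2)] by (auto simp: sum_distrib_right mult.assoc intro!: sum.cong)
qed

text \<open>\<open>F0\<close> collects the first edges of the ghost parts based at \<open>v\<close>.
  Their ghosts vanish against \<open>gap v F\<close>, and so do ghost parts based elsewhere; only
  real paths ending at \<open>v\<close> remain, which gives one \<open>b\<close> for all large
  \<open>F\<close>. For \<open>n = 0\<close> no edge is collected, and \<open>gap v {}\<close> is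
  the vertex.\<close>

lemma mono_span_gap:
  assumes "a \<in> mono_span n" "v \<in> verts E"
  shows "\<exists>F0 b. finite F0 \<and> F0 \<subseteq> out_arcs E v \<and> (n = 0 \<longrightarrow> F0 = {}) \<and> b \<in> path_span v \<and>
    (\<forall>F. finite F \<and> F0 \<subseteq> F \<and> F \<subseteq> out_arcs E v \<longrightarrow> a * gap v F = b * gap v F)"
  using assms(1)
proof induction
  case zero
  show ?case
    by (rule exI[of _ "{}"], rule exI[of _ 0]) (simp add: path_span_zero)
next
  case (add a x p u w q k)
  obtain F0 b where F0: "finite F0" "F0 \<subseteq> out_arcs E v" "n = 0 \<longrightarrow> F0 = {}"
    and b: "b \<in> path_span v" "\<forall>F. finite F \<and> F0 \<subseteq> F \<and> F \<subseteq> out_arcs E v \<longrightarrow>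
      a * gap v F = b * gap v F"
    using add.IH by (elim exE conjE) (rule that; assumption)
  let ?m = "sc k * (path x p * ghost_path w q)"
  have w: "w \<in> verts E"
    using add.hyps(3) by (rule awalk_hd_in_verts)
  consider "w \<noteq> v" | "w = v" "q = []" | e q' where "w = v" "q = e # q'"
    by (cases q) auto
  then show ?case
  proof cases
    case 1
    have "?m * gap v F = 0" if "finite F" "F \<subseteq> out_arcs E v" for F
    proof -
      have "ghost_path w q * gap v F = ghost_path w q * V w * gap v F"
        using ghost_path_V[OF w add.hyps(3)] by simp
      also have "\<dots> = 0"
        using V_gap[OF that assms(2) w] 1 by (simp add: mult.assoc)
      finally show ?thesis
        by (simp add: mult.assoc)
    qed
    then show ?thesis
      using F0 b by (intro exI[of _ F0] exI[of _ b]) (auto simp: distrib_right)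
  next
    case 2
    then have "awalk x p v"
      using add.hyps by (auto simp: awalk_simps)
    then have "b + sc k * path x p \<in> path_span v"
      by (rule path_span_add[OF b(1)])
    moreover have "?m * gap v F = sc k * path x p * gap v F" if "finite F" "F \<subseteq> out_arcs E v" for F
      using V_gap[OF that assms(2) assms(2)] 2 by (simp add: mult.assoc)
    ultimately show ?thesis
      using F0 b by (intro exI[of _ F0] exI[of _ "b + sc k * path x p"]) (auto simp: distrib_right)
  next
    case 3
    then have e: "e \<in> out_arcs E v"
      using add.hyps by (auto simp: awalk_simps)
    have "?m * gap v F = 0" if "finite F" "F \<subseteq> out_arcs E v" "e \<in> F" for F
      using gh_gap[OF that(1,2) e] that(3) 3 by (simp add: mult.assoc)
    then show ?thesis
      using F0 b e 3 add.hyps(4)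
      by (intro exI[of _ "insert e F0"] exI[of _ b]) (auto simp: distrib_right)
  qed
qed

text \<open>Multiplying by the ghost of a shortest path occurring in \<open>b\<close> leaves, apart from the
  vertex \<open>w\<close>, only closed paths at \<open>w\<close>.\<close>

lemma path_span_ghost_path:
  assumes "b \<in> path_span w" "b \<noteq> 0"
  obtains v p k l q and S :: "('v \<times> 'e list) set" where "awalk v p w" "k \<noteq> 0" "finite S"
    "\<And>i. i \<in> S \<Longrightarrow> awalk w (q i) w" "\<And>i. i \<in> S \<Longrightarrow> q i \<noteq> []"
    "ghost_path v p * b = sc k * V w + (\<Sum>i\<in>S. sc (l i) * path w (q i))"
proof -
  obtain S0 k where S0: "finite S0" "\<forall>i\<in>S0. awalk (fst i) (snd i) w"
    and b0: "b = (\<Sum>i\<in>S0. sc (k i) * path (fst i) (snd i))"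
    using assms(1) by (auto simp: path_span_def)
  \<comment> \<open>Zero coefficients are discarded, so that the selected shortest path has an
    invertible coefficient.\<close>
  define S where "S = {i \<in> S0. k i \<noteq> 0}"
  have S: "finite S" "\<And>i. i \<in> S \<Longrightarrow> awalk (fst i) (snd i) w" "\<And>i. i \<in> S \<Longrightarrow> k i \<noteq> 0"
    using S0 by (auto simp: S_def)
  have b: "b = (\<Sum>i\<in>S. sc (k i) * path (fst i) (snd i))"
    unfolding b0 S_def using S0(1) by (intro sum.mono_neutral_right) auto
  then have "S \<noteq> {}"
    using assms(2) by auto
  then obtain j where j: "j \<in> S" and min: "\<And>i. i \<in> S \<Longrightarrow> length (snd j) \<le> length (snd i)"
    using ex_has_least_nat[of "\<lambda>i. i \<in> S" _ "\<lambda>i. length (snd i)"] by blast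
  obtain v p where vp: "j = (v, p)"
    by (cases j)
  have p: "awalk v p w"
    using S(2)[OF j] vp by simp
  define S' where "S' = {i \<in> S. fst i = v \<and> strict_prefix p (snd i)}"
  define q where "q i = drop (length p) (snd i)" for i :: "'v \<times> 'e list"
  have S': "snd i = p @ q i" "q i \<noteq> []" "awalk w (q i) w" if "i \<in> S'" for i
  proof -
    show i: "snd i = p @ q i" "q i \<noteq> []"
      using that by (auto simp: S'_def q_def strict_prefix_def prefix_def)
    have "awalk v (snd i) w"
      using that S(2)[of i] by (auto simp: S'_def)
    then show "awalk w (q i) w"
      using closed_awalk_appendD[of v p "q i" w w] p i(1) by simp
  qed
  \<comment> \<open>Such a path starts at another vertex or, as \<open>p\<close> is shortest, is
    incomparable with \<open>p\<close>.\<close>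
  have zero: "ghost_path v p * path (fst i) (snd i) = 0" if i: "i \<in> S - {j} - S'" for i
  proof (cases "fst i = v")
    case False
    then show ?thesis
      using ghost_path_path_vertex_diff[OF p, of "fst i" "snd i" w] S(2)[of i] i by simp
  next
    case True
    have "snd i \<noteq> p"
      using i True vp by (metis DiffD1 DiffD2 insertI1 prod.collapse)
    moreover have "\<not> strict_prefix p (snd i)"
      using i True by (auto simp: S'_def)
    moreover have "length p \<le> length (snd i)"
      using min[of i] i vp by simp
    ultimately have "\<not> prefix p (snd i)" "\<not> prefix (snd i) p"
      by (auto simp: strict_prefix_def prefix_def)
    then show ?thesis
      using ghost_path_path_diff[OF p, of "snd i" w] S(2)[of i] i True by simp
  qed
  have "ghost_path v p * b = (\<Sum>i\<in>S. sc (k i) * (ghost_path v p * path (fst i) (snd i)))"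
    by (simp add: b sum_distrib_left subalg_sc[OF subalg_ghost_path[OF p]])
  also have "\<dots> = sc (k j) * (ghost_path v p * path v p)
      + (\<Sum>i\<in>S - {j}. sc (k i) * (ghost_path v p * path (fst i) (snd i)))"
    using S(1) j vp by (simp add: sum.remove)
  also have "(\<Sum>i\<in>S - {j}. sc (k i) * (ghost_path v p * path (fst i) (snd i)))
      = (\<Sum>i\<in>S'. sc (k i) * path w (q i))"
  proof (rule sum.mono_neutral_cong_right)
    show "S' \<subseteq> S - {j}"
      using vp by (auto simp: S'_def)
    show "sc (k i) * (ghost_path v p * path (fst i) (snd i)) = sc (k i) * path w (q i)"
      if "i \<in> S'" for i
      using S'[OF that] that ghost_path_path[OF p, of "q i" w] by (simp add: S'_def)
  qed (use S(1) zero in auto)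
  finally have "ghost_path v p * b = sc (k j) * V w + (\<Sum>i\<in>S'. sc (k i) * path w (q i))"
    using ghost_path_path_same[OF p] by simp
  then show thesis
    using that[OF p S(3)[OF j], of S' q k] S'(2,3) S(1) by (simp add: S'_def)
qed

text \<open>The idempotent will be kept outside some primitive ideal above \<open>I\<close>; being a
  multiple of \<open>a\<close>, it keeps \<open>a\<close> outside as well.\<close>

definition reducible :: "'a \<Rightarrow> bool" where
  "reducible a \<longleftrightarrow> (\<exists>x\<in>subalg. \<exists>y\<in>subalg. x * a * y \<noteq> 0 \<and> (x * a * y) * (x * a * y) = x * a * y)"

lemma reducible_mult_right: "reducible (a * z) \<Longrightarrow> z \<in> subalg \<Longrightarrow> reducible a"
  unfolding reducible_def by (metis mult.assoc subalg_mult)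

lemma reducibleI:
  assumes "x \<in> subalg" "y \<in> subalg" "x * a * y = sc k * p" "k \<noteq> 0" "p \<noteq> 0" "p * p = p"
  shows "reducible a"
proof -
  have "(sc (inverse k) * x) * a * y = sc (inverse k) * (sc k * p)"
    by (simp add: mult.assoc[symmetric] assms(3)[symmetric])
  also have "\<dots> = p"
    using assms(4) by (simp add: mult.assoc[symmetric] sc_mult[symmetric] sc_one)
  finally show ?thesis
    unfolding reducible_def using assms subalg_scale by metis
qed

text \<open>The separating path is taken for the finitely many closed paths left by
  \<open>path_span_ghost_path\<close>, so conjugation keeps only the multiple of \<open>w\<close>.
  The vertex is nonzero because \<open>b w = b\<close>.\<close>

lemma reducible_path_span:
  assumes K: "condition_K E" and b: "b \<in> path_span w" "b \<noteq> 0" and w: "w \<in> verts E"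
  shows "reducible b"
proof -
  obtain v p k l q and S :: "('v \<times> 'e list) set" where p: "awalk v p w" "k \<noteq> 0" and S: "finite S"
    "\<And>i. i \<in> S \<Longrightarrow> awalk w (q i) w" "\<And>i. i \<in> S \<Longrightarrow> q i \<noteq> []"
    and eq: "ghost_path v p * b = sc k * V w + (\<Sum>i\<in>S. sc (l i) * path w (q i))"
    by (rule path_span_ghost_path[OF b]) (rule that; assumption)
  obtain c where c: "awalk w c w"
    and sep: "\<And>p. p \<in> q ` S \<Longrightarrow> awalk w p w \<Longrightarrow> p \<noteq> [] \<Longrightarrow> \<not> prefix c (p @ c)"
    using condition_K_separating_path[OF K w, where N = "q ` S"] S(1) by auto
  have "ghost_path w c * (path w (q i) * path w c) = 0" if "i \<in> S" for i
  proof -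
    have "\<not> prefix c (q i @ c)" "\<not> prefix (q i @ c) c"
      using sep[of "q i"] S that by (auto dest: prefix_length_le)
    then show ?thesis
      using ghost_path_path_diff[OF c awalk_appendI[OF S(2)[OF that] c]]
      by (simp add: path_append[OF S(2)[OF that] c])
  qed
  then have "(\<Sum>i\<in>S. sc (l i) * (ghost_path w c * (path w (q i) * path w c))) = 0"
    by simp
  moreover have "ghost_path w c * (V w * path w c) = V w"
    using V_path[OF w c] ghost_path_path_same[OF c] by simp
  moreover have "ghost_path w c * (ghost_path v p * b) * path w c
      = sc k * (ghost_path w c * (V w * path w c))
        + (\<Sum>i\<in>S. sc (l i) * (ghost_path w c * (path w (q i) * path w c)))"
    unfolding eq by (simp add: mult.assoc distrib_left distrib_right sum_distrib_left
        sum_distrib_right subalg_sc[OF subalg_ghost_path[OF c]])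
  ultimately have "(ghost_path w c * ghost_path v p) * b * path w c = sc k * V w"
    by (simp add: mult.assoc)
  moreover have "V w \<noteq> 0"
    using path_span_V[OF b(1) w] b(2) by auto
  ultimately show ?thesis
    using p(2) c p(1) w
    by (intro reducibleI[of "ghost_path w c * ghost_path v p" "path w c" b k "V w"])
      (auto simp: subalg_mult subalg_ghost_path subalg_path V_V)
qed

text \<open>If no edge at \<open>v\<close> lowers the ghost degree, then \<open>a v = b gap\<close>
  for every large finite \<open>F\<close>. The outcome depends on the edges at \<open>v\<close> that
  survive in the ring. If they are finite in number, put them into \<open>F\<close>: the gap then
  annihilates all nontrivial closed paths at \<open>v\<close> from the left. If there are infinitely
  many, a contradiction arises.\<close>

theorem condition_K_reducible:
  assumes K: "condition_K E" and a: "a \<in> mono_span n" "a \<noteq> 0"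
  shows "reducible a"
  using a
proof (induction n arbitrary: a)
  case 0
  obtain v where v: "v \<in> verts E" "a * V v \<noteq> 0"
    using mono_span_V_nonzero[OF 0] .
  obtain b where b: "b \<in> path_span v" "a * gap v {} = b * gap v {}"
    using mono_span_gap[OF 0(1) v(1)] by auto
  then have "a * V v = b"
    using path_span_V[OF b(1) v(1)] by (simp add: gap_def)
  then have "reducible (a * V v)"
    using reducible_path_span[OF K b(1) _ v(1)] v(2) by simp
  then show ?case
    using subalg_V[OF v(1)] by (rule reducible_mult_right)
next
  case (Suc n)
  obtain v where v: "v \<in> verts E" "a * V v \<noteq> 0"
    using mono_span_V_nonzero[OF Suc.prems] .
  show ?case
  proof (cases "\<exists>e\<in>out_arcs E v. a * ed e \<noteq> 0")
    case True
    then obtain e where "e \<in> arcs E" "a * ed e \<noteq> 0"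
      by auto
    then show ?thesis
      using Suc.IH mono_span_ed[OF Suc.prems(1)] reducible_mult_right subalg_ed by blast
  next
    case False
    then have ae: "a * ed e = 0" if "e \<in> out_arcs E v" for e
      using that by blast
    obtain F0 b where F0: "finite F0" "F0 \<subseteq> out_arcs E v" and b: "b \<in> path_span v"
      and ab: "\<forall>F. finite F \<and> F0 \<subseteq> F \<and> F \<subseteq> out_arcs E v \<longrightarrow> a * gap v F = b * gap v F"
      using mono_span_gap[OF Suc.prems(1) v(1)] by (elim exE conjE) (rule that; assumption)
    have av: "a * V v = b * gap v F" if F: "finite F" "F0 \<subseteq> F" "F \<subseteq> out_arcs E v" for F
    proof -
      have "(\<Sum>f\<in>F. a * (ed f * gh f)) = 0"
        using F ae by (intro sum.neutral) (auto simp: mult.assoc[symmetric])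
      then have "a * gap v F = a * V v"
        by (simp add: gap_def right_diff_distrib sum_distrib_left)
      then show ?thesis
        using ab F by simp
    qed
    have "b \<noteq> 0"
      using av[OF F0(1) order_refl F0(2)] v(2) by auto
    obtain x p k l q and S :: "('v \<times> 'e list) set" where p: "awalk x p v" "k \<noteq> 0" and S: "finite S"
      "\<And>i. i \<in> S \<Longrightarrow> awalk v (q i) v" "\<And>i. i \<in> S \<Longrightarrow> q i \<noteq> []"
      and eq: "ghost_path x p * b = sc k * V v + (\<Sum>i\<in>S. sc (l i) * path v (q i))"
      by (rule path_span_ghost_path[OF b \<open>b \<noteq> 0\<close>]) (rule that; assumption)
    have q: "hd (q i) \<in> out_arcs E v" "path v (q i) = ed (hd (q i)) * path (head E (hd (q i))) (tl (q i))"
      if "i \<in> S" for i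
      using S(2,3)[OF that] by (cases "q i"; auto simp: awalk_simps)+
    define N where "N = {e \<in> out_arcs E v. ed e \<noteq> 0}"
    show ?thesis
    proof (cases "finite N")
      case True
      define F where "F = F0 \<union> N"
      have F: "finite F" "F0 \<subseteq> F" "F \<subseteq> out_arcs E v"
        using True F0 by (auto simp: F_def N_def)
      have gap_q: "gap v F * path v (q i) = 0" if "i \<in> S" for i
        using gap_ed[OF F(1,3) q(1)[OF that]] q[OF that]
        by (auto simp: mult.assoc[symmetric] F_def N_def)
      have gap_sub: "gap v F \<in> subalg"
        using F(1,3) v(1) by (intro subalg_gap) auto
      have "gap v F * (ghost_path x p * b) = sc k * gap v F"
        unfolding eq using gap_q
        by (simp add: distrib_left sum_distrib_left subalg_sc[OF gap_sub] gap_V[OF F(1,3) v(1)])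
      then have "gap v F * (ghost_path x p * b) * gap v F = sc k * gap v F"
        by (simp add: mult.assoc gap_idem[OF F(1,3) v(1)])
      then have "gap v F * ghost_path x p * a * V v = sc k * gap v F"
        using av[OF F] by (simp add: mult.assoc)
      moreover have "gap v F \<noteq> 0"
        using av[OF F] v(2) by auto
      ultimately show ?thesis
        using p gap_idem[OF F(1,3) v(1)] gap_sub subalg_V[OF v(1)]
        by (intro reducibleI[of "gap v F * ghost_path x p" "V v" a k "gap v F"])
          (auto simp: subalg_mult subalg_ghost_path)
    next
      case False
      \<comment> \<open>A surviving edge \<open>e\<close> outside \<open>F0\<close> that begins none
        of the closed paths: \<open>b e\<close> vanishes because \<open>a e\<close> does, yet
        multiplying \<open>b e\<close> on the left by the ghosts of \<open>p\<close> and
        \<open>e\<close> gives \<open>k\<close> times the range of \<open>e\<close>. So that range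
        vanishes, and \<open>e\<close> with it.\<close>
      then have "infinite (N - F0 - (\<lambda>i. hd (q i)) ` S)"
        using F0(1) S(1) by simp
      then have "N - F0 - (\<lambda>i. hd (q i)) ` S \<noteq> {}"
        by (rule infinite_imp_nonempty)
      then obtain e where e: "e \<in> N - F0 - (\<lambda>i. hd (q i)) ` S"
        by blast
      then have eo: "e \<in> out_arcs E v" "e \<in> arcs E" "tail E e = v" "ed e \<noteq> 0" "e \<notin> F0"
        by (auto simp: N_def)
      have "b * ed e = b * gap v F0 * ed e"
        using gap_ed[OF F0 eo(1)] eo(5) by (simp add: mult.assoc)
      also have "\<dots> = a * (V v * ed e)"
        using av[OF F0(1) order_refl F0(2)] by (simp add: mult.assoc[symmetric])
      also have "\<dots> = 0"
        using V_ed[OF v(1) eo(2)] eo(3) ae[OF eo(1)] by simp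
      finally have "gh e * (ghost_path x p * b) * ed e = 0"
        by (simp add: mult.assoc)
      moreover have "gh e * (ghost_path x p * b) * ed e = sc k * (gh e * (V v * ed e))
          + (\<Sum>i\<in>S. sc (l i) * (gh e * (path v (q i) * ed e)))"
        unfolding eq by (simp add: mult.assoc distrib_left distrib_right sum_distrib_left
            sum_distrib_right subalg_sc[OF subalg_gh[OF eo(2)]])
      moreover have "gh e * (path v (q i) * ed e) = 0" if "i \<in> S" for i
      proof -
        have "gh e * ed (hd (q i)) = 0"
          using q(1)[OF that] e that gh_ed[OF eo(2), of "hd (q i)"] by auto
        then show ?thesis
          using q(2)[OF that] by (metis mult.assoc mult_zero_left)
      qed
      moreover have "gh e * (V v * ed e) = V (head E e)"
        using V_ed[OF v(1) eo(2)] eo gh_ed[OF eo(2,2)] by simp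
      ultimately have "sc k * V (head E e) = 0"
        by simp
      then have "sc (inverse k) * (sc k * V (head E e)) = 0"
        by simp
      then have "V (head E e) = 0"
        using p(2) by (simp add: mult.assoc[symmetric] sc_mult[symmetric] sc_one)
      then show ?thesis
        using ed_V[of "head E e" e] eo head_tail_in_verts by simp
    qed
  qed
qed

end


section \<open>Primitive ideals of rings without identity\<close>

context rng
begin

lemma rng_l_null: "x \<in> carrier R \<Longrightarrow> \<zero> \<otimes> x = \<zero>"
  using rng_l_distr[of \<zero> \<zero> x] add.l_cancel_one[of "\<zero> \<otimes> x" "\<zero> \<otimes> x"] by (simp add: rng_m_closed)

lemma rng_r_null: "x \<in> carrier R \<Longrightarrow> x \<otimes> \<zero> = \<zero>"
  using rng_r_distr[of \<zero> \<zero> x] add.l_cancel_one[of "x \<otimes> \<zero>" "x \<otimes> \<zero>"] by (simp add: rng_m_closed)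

lemma rng_l_minus: "x \<in> carrier R \<Longrightarrow> y \<in> carrier R \<Longrightarrow> \<ominus> x \<otimes> y = \<ominus> (x \<otimes> y)"
  using rng_l_distr[of "\<ominus> x" x y]
  by (intro minus_equality[symmetric]) (simp_all add: rng_m_closed l_neg rng_l_null)

lemma rng_r_minus: "x \<in> carrier R \<Longrightarrow> y \<in> carrier R \<Longrightarrow> x \<otimes> \<ominus> y = \<ominus> (x \<otimes> y)"
  using rng_r_distr[of "\<ominus> y" y x]
  by (intro minus_equality[symmetric]) (simp_all add: rng_m_closed l_neg rng_r_null)

definition left_ideal :: "'a set \<Rightarrow> bool" where
  "left_ideal N \<longleftrightarrow> N \<subseteq> carrier R \<and> \<zero> \<in> N \<and> (\<forall>a\<in>N. \<forall>b\<in>N. a \<oplus> b \<in> N) \<and>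
    (\<forall>a\<in>N. \<ominus> a \<in> N) \<and> (\<forall>x\<in>carrier R. \<forall>a\<in>N. x \<otimes> a \<in> N)"

lemma left_idealD:
  assumes "left_ideal N"
  shows "N \<subseteq> carrier R" "\<zero> \<in> N" "\<And>a b. a \<in> N \<Longrightarrow> b \<in> N \<Longrightarrow> a \<oplus> b \<in> N"
    "\<And>a. a \<in> N \<Longrightarrow> \<ominus> a \<in> N" "\<And>x a. x \<in> carrier R \<Longrightarrow> a \<in> N \<Longrightarrow> x \<otimes> a \<in> N"
  using assms by (auto simp: left_ideal_def)

lemma left_ideal_abelian_subgroup:
  assumes "left_ideal N"
  shows "abelian_subgroup N R"
proof (rule abelian_subgroupI3)
  show "additive_subgroup N R"
    using left_idealD[OF assms]
    by (intro additive_subgroup.intro subgroup.intro) (auto simp: a_inv_def[symmetric])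
qed (rule abelian_group_axioms)

lemma left_ideal_Union_chain:
  assumes "C \<noteq> {}" "subset.chain {N. left_ideal N} C"
  shows "left_ideal (\<Union>C)"
proof -
  have N: "left_ideal N" if "N \<in> C" for N
    using assms(2) that by (auto simp: subset.chain_def)
  have sub: "N \<subseteq> N' \<or> N' \<subseteq> N" if "N \<in> C" "N' \<in> C" for N N'
    using assms(2) that by (auto simp: subset_chain_def)
  have "a \<oplus> b \<in> \<Union>C" if ab: "a \<in> \<Union>C" "b \<in> \<Union>C" for a b
  proof -
    obtain N1 N2 where *: "N1 \<in> C" "a \<in> N1" "N2 \<in> C" "b \<in> N2"
      using ab by blast
    then obtain N where "N \<in> C" "a \<in> N" "b \<in> N"
      using sub[of N1 N2] by blast
    then show ?thesis
      using left_idealD(3)[OF N] by blast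
  qed
  moreover have "\<Union>C \<subseteq> carrier R"
    using left_idealD(1)[OF N] by blast
  moreover have "\<zero> \<in> \<Union>C"
    using left_idealD(2)[OF N] assms(1) by blast
  moreover have "\<forall>a\<in>\<Union>C. \<ominus> a \<in> \<Union>C"
    using left_idealD(4)[OF N] by blast
  moreover have "\<forall>x\<in>carrier R. \<forall>a\<in>\<Union>C. x \<otimes> a \<in> \<Union>C"
    using left_idealD(5)[OF N] by blast
  ultimately show ?thesis
    by (simp add: left_ideal_def)
qed

text \<open>\<open>p\<close> acts as an identity on the right modulo \<open>N\<close>, so every left ideal strictly above a maximal
  \<open>N\<close> contains \<open>p\<close>, hence every \<open>x = (x - x p) + x p\<close>.\<close>

lemma maximal_left_ideal_simple_module:
  assumes N: "left_ideal N" and p: "p \<in> carrier R" "p \<notin> N" "p \<otimes> p \<notin> N"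
    and mod: "\<And>x. x \<in> carrier R \<Longrightarrow> x \<ominus> x \<otimes> p \<in> N"
    and max: "\<And>N'. left_ideal N' \<Longrightarrow> N \<subseteq> N' \<Longrightarrow> p \<notin> N' \<Longrightarrow> N' = N"
  obtains P where "primitive_rng_ideal P R" "p \<notin> P"
    "\<And>a. a \<in> P \<longleftrightarrow> a \<in> carrier R \<and> (\<forall>x\<in>carrier R. a \<otimes> x \<in> N)"
proof -
  interpret N: abelian_subgroup N R
    using N by (rule left_ideal_abelian_subgroup)
  note Nsub = left_idealD(1)[OF N] and N_l = left_idealD(5)[OF N]
  define M :: "('a, 'a set) module" where
    "M = \<lparr>carrier = (\<lambda>x. N +> x) ` carrier R, mult = undefined, one = undefined, zero = N +> \<zero>,
       add = set_add R, smult = (\<lambda>r C. \<Union>x\<in>C. N +> (r \<otimes> x))\<rparr>"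
  have smult: "r \<odot>\<^bsub>M\<^esub> (N +> x) = N +> (r \<otimes> x)" if "r \<in> carrier R" "x \<in> carrier R" for r x
  proof -
    have "N +> (r \<otimes> y) = N +> (r \<otimes> x)" if y: "y \<in> N +> x" for y
    proof -
      obtain n where n: "n \<in> N" "y = n \<oplus> x"
        using y by (auto simp: a_r_coset_def')
      then have "r \<otimes> y = r \<otimes> n \<oplus> r \<otimes> x"
        using \<open>r \<in> carrier R\<close> \<open>x \<in> carrier R\<close> Nsub by (auto simp: rng_r_distr)
      moreover have "r \<otimes> n \<in> N"
        using N_l n \<open>r \<in> carrier R\<close> by blast
      ultimately have "r \<otimes> y \<in> N +> (r \<otimes> x)"
        by (auto simp: a_r_coset_def')
      then show ?thesis
        using N.a_repr_independence'[of "r \<otimes> y" "r \<otimes> x"]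
          \<open>r \<in> carrier R\<close> \<open>x \<in> carrier R\<close> by (simp add: rng_m_closed)
    qed
    moreover have "x \<in> N +> x"
      using that N.a_rcos_self by blast
    ultimately have "(\<Union>y\<in>N +> x. N +> (r \<otimes> y)) = N +> (r \<otimes> x)"
      by (intro UN_constant_eq ballI)
    then show ?thesis
      by (simp add: M_def)
  qed
  have M [simp]: "carrier M = (\<lambda>x. N +> x) ` carrier R" "\<zero>\<^bsub>M\<^esub> = N +> \<zero>"
    by (simp_all add: M_def)
  have add [simp]: "(N +> x) \<oplus>\<^bsub>M\<^esub> (N +> y) = N +> (x \<oplus> y)" if "x \<in> carrier R" "y \<in> carrier R" for x y
    using that by (simp add: M_def N.a_rcos_sum)
  have zero_iff: "N +> x = N +> \<zero> \<longleftrightarrow> x \<in> N" if "x \<in> carrier R" for x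
  proof
    assume "N +> x = N +> \<zero>"
    then have "x \<in> N +> \<zero>"
      using that N.a_rcos_self by metis
    then show "x \<in> N"
      using Nsub by (auto simp: a_r_coset_def')
  next
    assume "x \<in> N"
    then show "N +> x = N +> \<zero>"
      using N.a_rcos_const left_idealD(2)[OF N] by simp
  qed
  have M_group: "abelian_group M"
  proof (rule abelian_groupI)
    fix C assume "C \<in> carrier M"
    then obtain x where "x \<in> carrier R" "C = N +> x"
      by auto
    then show "\<exists>D\<in>carrier M. D \<oplus>\<^bsub>M\<^esub> C = \<zero>\<^bsub>M\<^esub>"
      by (intro bexI[of _ "N +> (\<ominus> x)"]) (auto simp: l_neg)
  qed (auto simp: a_ac)
  interpret M: abelian_group M
    by (fact M_group)
  have minus: "\<ominus>\<^bsub>M\<^esub> (N +> x) = N +> (\<ominus> x)" if "x \<in> carrier R" for x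
    using that by (intro M.minus_equality) (auto simp: l_neg)
  have M_module: "rng_left_module R M"
    by (intro rng_left_module.intro rng_left_module_axioms.intro rng_axioms M_group)
      (auto simp: smult rng_m_closed rng_l_distr rng_r_distr rng_m_assoc)
  have simple: "S = {\<zero>\<^bsub>M\<^esub>} \<or> S = carrier M" if "submodule S R M" for S
  proof (rule disjCI)
    assume "S \<noteq> carrier M"
    interpret S: submodule S R M
      by (fact that)
    define N' where "N' = {x \<in> carrier R. N +> x \<in> S}"
    have add_S: "N +> (x \<oplus> y) \<in> S" if "x \<in> N'" "y \<in> N'" for x y
      using S.m_closed[of "N +> x" "N +> y"] that by (simp add: N'_def)
    have "N' \<subseteq> carrier R" "\<zero> \<in> N'"
      using S.one_closed by (auto simp: N'_def)
    moreover have "\<forall>a\<in>N'. \<forall>b\<in>N'. a \<oplus> b \<in> N'"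
      using add_S by (auto simp: N'_def)
    moreover have "\<forall>a\<in>N'. \<ominus> a \<in> N'"
    proof
      fix a assume "a \<in> N'"
      then show "\<ominus> a \<in> N'"
        using S.m_inv_closed[of "N +> a"] minus[of a] by (simp add: N'_def a_inv_def)
    qed
    moreover have "\<forall>x\<in>carrier R. \<forall>a\<in>N'. x \<otimes> a \<in> N'"
      using S.smult_closed by (force simp: N'_def smult[symmetric] rng_m_closed)
    ultimately have left: "left_ideal N'"
      by (simp add: left_ideal_def)
    have "N \<subseteq> N'"
    proof
      fix x assume "x \<in> N"
      then have "x \<in> carrier R" "N +> x = N +> \<zero>"
        using zero_iff Nsub by auto
      then show "x \<in> N'"
        using S.one_closed by (simp add: N'_def)
    qed
    have "p \<notin> N'"
    proof
      assume "p \<in> N'"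
      have "x \<in> N'" if x: "x \<in> carrier R" for x
      proof -
        have "x \<otimes> p \<in> N'" "x \<ominus> x \<otimes> p \<in> N'"
          using left_idealD(5)[OF left x \<open>p \<in> N'\<close>] mod[OF x] \<open>N \<subseteq> N'\<close> by auto
        then have "(x \<ominus> x \<otimes> p) \<oplus> x \<otimes> p \<in> N'"
          using left_idealD(3)[OF left] by blast
        then show ?thesis
          using x p(1) by (simp add: minus_eq a_assoc rng_m_closed l_neg)
      qed
      then have "carrier M \<subseteq> S"
        by (auto simp: N'_def)
      then show False
        using S.subset \<open>S \<noteq> carrier M\<close> by auto
    qed
    then have "N' = N"
      using max left \<open>N \<subseteq> N'\<close> by blast
    have "C = \<zero>\<^bsub>M\<^esub>" if "C \<in> S" for C
    proof -
      have "C \<in> carrier M"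
        using S.subset that by auto
      then obtain x where x: "x \<in> carrier R" "C = N +> x"
        by auto
      then have "x \<in> N"
        using that \<open>N' = N\<close> by (auto simp: N'_def)
      then show ?thesis
        using x zero_iff by simp
    qed
    moreover have "\<zero>\<^bsub>M\<^esub> \<in> S"
      using S.one_closed by simp
    ultimately show "S = {\<zero>\<^bsub>M\<^esub>}"
      by blast
  qed
  \<comment> \<open>The coset of \<open>p\<close> witnesses both that \<open>R M\<close> is nonzero
    and that \<open>p\<close> is not in the annihilator.\<close>
  have pp: "p \<odot>\<^bsub>M\<^esub> (N +> p) \<noteq> \<zero>\<^bsub>M\<^esub>"
    using p zero_iff[of "p \<otimes> p"] by (simp add: smult rng_m_closed)
  moreover have "N +> p \<in> carrier M"
    using p by simp
  ultimately have "simple_left_module R M"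
    unfolding simple_left_module_def using M_module simple p(1) by blast
  then have "primitive_rng_ideal (left_annihilator R M) R"
    by (rule primitive_rng_idealI)
  moreover have "p \<notin> left_annihilator R M"
    using pp \<open>N +> p \<in> carrier M\<close> by (auto simp: left_annihilator_def)
  moreover have "a \<in> left_annihilator R M \<longleftrightarrow> a \<in> carrier R \<and> (\<forall>x\<in>carrier R. a \<otimes> x \<in> N)" for a
    by (simp add: left_annihilator_def smult zero_iff rng_m_closed cong: conj_cong)
  ultimately show thesis
    by (rule that)
qed

text \<open>\<open>N0\<close> is a modular left ideal with right unit \<open>p\<close>:
  \<open>(x - x p) p\<close> equals \<open>- x (p p - p)\<close>, which lies in \<open>I\<close>.
  Maximality is taken among the left ideals above \<open>N0\<close> that miss \<open>p\<close>. The
  annihilator contains \<open>I\<close> because \<open>I\<close> also absorbs right factors.\<close>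

lemma idempotent_primitive_rng_ideal:
  assumes I: "rng_ideal I R" and p: "p \<in> carrier R" "p \<notin> I" "p \<otimes> p \<ominus> p \<in> I"
  obtains P where "primitive_rng_ideal P R" "I \<subseteq> P" "p \<notin> P"
proof -
  interpret I: rng_ideal I R
    by (fact I)
  note I_closed = additive_subgroup.zero_closed[OF I.additive_subgroup_axioms]
    additive_subgroup.a_closed[OF I.additive_subgroup_axioms]
    additive_subgroup.a_inv_closed[OF I.additive_subgroup_axioms]
    and I_sub = additive_subgroup.a_subset[OF I.additive_subgroup_axioms]
  have pp: "p \<otimes> p \<notin> N" if "p \<otimes> p \<ominus> p \<in> N" "p \<notin> N" "left_ideal N" for N
  proof
    assume "p \<otimes> p \<in> N"
    then have "\<ominus> (p \<otimes> p \<ominus> p) \<oplus> p \<otimes> p \<in> N"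
      using that left_idealD by metis
    moreover have "\<ominus> (p \<otimes> p \<ominus> p) \<oplus> p \<otimes> p = p"
      using p(1) by (simp add: minus_eq minus_add a_ac rng_m_closed l_neg r_neg)
    ultimately show False
      using that by simp
  qed
  define N0 where "N0 = {x \<in> carrier R. x \<otimes> p \<in> I}"
  have N0: "left_ideal N0"
    unfolding left_ideal_def N0_def using p(1) I_closed I.rng_I_l_closed
    by (auto simp: rng_l_null rng_l_distr rng_l_minus rng_m_assoc rng_m_closed)
  have "I \<subseteq> N0"
    using I_sub I.rng_I_r_closed p(1) by (auto simp: N0_def)
  have mod: "x \<ominus> x \<otimes> p \<in> N0" if x: "x \<in> carrier R" for x
  proof -
    have "\<ominus> (x \<otimes> (p \<otimes> p \<ominus> p)) \<in> I"
      using I_closed I.rng_I_l_closed[OF p(3) x] by blast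
    moreover have "\<ominus> (x \<otimes> (p \<otimes> p \<ominus> p)) = (x \<ominus> x \<otimes> p) \<otimes> p"
      using x p(1)
      by (simp add: minus_eq minus_add a_ac rng_l_distr rng_r_distr rng_l_minus rng_r_minus
          rng_m_assoc rng_m_closed)
    ultimately show ?thesis
      using x p(1) by (simp add: N0_def rng_m_closed)
  qed
  have "left_ideal I"
    unfolding left_ideal_def using I_closed I_sub I.rng_I_l_closed by auto
  then have "p \<notin> N0"
    using pp[OF p(3,2)] by (simp add: N0_def)
  define \<A> where "\<A> = {N. left_ideal N \<and> N0 \<subseteq> N \<and> p \<notin> N}"
  have "\<exists>N\<in>\<A>. \<forall>N'\<in>\<A>. N \<subseteq> N' \<longrightarrow> N' = N"
  proof (rule subset_Zorn_nonempty)
    show "\<A> \<noteq> {}"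
      using N0 \<open>p \<notin> N0\<close> by (auto simp: \<A>_def)
    fix C assume C: "C \<noteq> {}" "subset.chain \<A> C"
    then have "subset.chain {N. left_ideal N} C"
      by (auto simp: subset_chain_def \<A>_def)
    then have "left_ideal (\<Union>C)"
      using C(1) by (rule left_ideal_Union_chain[rotated])
    moreover have "N0 \<subseteq> N \<and> p \<notin> N" if "N \<in> C" for N
      using C(2) that by (auto simp: subset_chain_def \<A>_def)
    ultimately show "\<Union>C \<in> \<A>"
      using C(1) by (auto simp: \<A>_def)
  qed
  then obtain N where N: "left_ideal N" "N0 \<subseteq> N" "p \<notin> N"
    and max: "\<And>N'. N' \<in> \<A> \<Longrightarrow> N \<subseteq> N' \<Longrightarrow> N' = N"
    by (auto simp: \<A>_def)
  have "p \<otimes> p \<notin> N"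
    using pp N \<open>I \<subseteq> N0\<close> p(3) by blast
  then obtain P where P: "primitive_rng_ideal P R" "p \<notin> P"
    "\<And>a. a \<in> P \<longleftrightarrow> a \<in> carrier R \<and> (\<forall>x\<in>carrier R. a \<otimes> x \<in> N)"
  proof (rule maximal_left_ideal_simple_module[OF N(1) p(1) N(3)])
    show "x \<ominus> x \<otimes> p \<in> N" if "x \<in> carrier R" for x
      using mod[OF that] N(2) by blast
    show "N' = N" if "left_ideal N'" "N \<subseteq> N'" "p \<notin> N'" for N'
      using that N(2) by (intro max) (auto simp: \<A>_def)
  qed (rule that; assumption)
  have "I \<subseteq> P"
    using P(3) I_sub I.rng_I_r_closed \<open>I \<subseteq> N0\<close> N(2) by blast
  with P that show thesis
    by blast
qed

end

section \<open>Modules, and primality of primitive ideals\<close>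

context rng_left_module
begin

lemma lm_l_null: "x \<in> carrier M \<Longrightarrow> \<zero>\<^bsub>R\<^esub> \<odot>\<^bsub>M\<^esub> x = \<zero>\<^bsub>M\<^esub>"
  using lm_smult_l_distr[of "\<zero>\<^bsub>R\<^esub>" "\<zero>\<^bsub>R\<^esub>" x]
    M.add.l_cancel_one[of "\<zero>\<^bsub>R\<^esub> \<odot>\<^bsub>M\<^esub> x" "\<zero>\<^bsub>R\<^esub> \<odot>\<^bsub>M\<^esub> x"]
  by (simp add: lm_smult_closed)

lemma lm_r_null: "a \<in> carrier R \<Longrightarrow> a \<odot>\<^bsub>M\<^esub> \<zero>\<^bsub>M\<^esub> = \<zero>\<^bsub>M\<^esub>"
  using lm_smult_r_distr[of a "\<zero>\<^bsub>M\<^esub>" "\<zero>\<^bsub>M\<^esub>"]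
    M.add.l_cancel_one[of "a \<odot>\<^bsub>M\<^esub> \<zero>\<^bsub>M\<^esub>" "a \<odot>\<^bsub>M\<^esub> \<zero>\<^bsub>M\<^esub>"]
  by (simp add: lm_smult_closed)

lemma lm_l_minus:
  "a \<in> carrier R \<Longrightarrow> x \<in> carrier M \<Longrightarrow> (\<ominus>\<^bsub>R\<^esub> a) \<odot>\<^bsub>M\<^esub> x = \<ominus>\<^bsub>M\<^esub> (a \<odot>\<^bsub>M\<^esub> x)"
  using lm_smult_l_distr[of "\<ominus>\<^bsub>R\<^esub> a" a x]
  by (intro M.minus_equality[symmetric]) (simp_all add: lm_smult_closed R.l_neg lm_l_null)

lemma left_annihilator_rng_ideal: "rng_ideal (left_annihilator R M) R"
proof (intro rng_ideal.intro rng_ideal_axioms.intro additive_subgroup.intro subgroup.intro)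
  show "rng R"
    by (rule R.rng_axioms)
qed (auto simp: left_annihilator_def lm_smult_l_distr lm_smult_assoc lm_smult_closed R.rng_m_closed
    lm_l_null lm_r_null lm_l_minus a_inv_def[symmetric])

lemma submodule_image_rng_ideal:
  assumes "rng_ideal B R" "x \<in> carrier M"
  shows "submodule ((\<lambda>b. b \<odot>\<^bsub>M\<^esub> x) ` B) R M"
proof -
  interpret B: rng_ideal B R
    by (fact assms(1))
  note B_closed = additive_subgroup.zero_closed[OF B.additive_subgroup_axioms]
    additive_subgroup.a_closed[OF B.additive_subgroup_axioms]
    additive_subgroup.a_inv_closed[OF B.additive_subgroup_axioms]
  have B_sub: "b \<in> carrier R" if "b \<in> B" for b
    using additive_subgroup.a_subset[OF B.additive_subgroup_axioms] that by blast
  let ?N = "(\<lambda>b. b \<odot>\<^bsub>M\<^esub> x) ` B"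
  show ?thesis
  proof (intro submodule.intro submodule_axioms.intro M.add.subgroupI)
    fix a y assume "a \<in> carrier R" "y \<in> ?N"
    then show "a \<odot>\<^bsub>M\<^esub> y \<in> ?N"
      using assms(2) B.rng_I_l_closed by (auto simp: lm_smult_assoc[symmetric] B_sub)
  next
    fix y z assume "y \<in> ?N" "z \<in> ?N"
    then obtain a b where "a \<in> B" "b \<in> B" "y = a \<odot>\<^bsub>M\<^esub> x" "z = b \<odot>\<^bsub>M\<^esub> x"
      by auto
    then show "y \<oplus>\<^bsub>M\<^esub> z \<in> ?N"
      using assms(2) B_closed(2)[of a b] by (auto simp: lm_smult_l_distr[symmetric] B_sub)
  next
    fix y assume "y \<in> ?N"
    then obtain a where "a \<in> B" "y = a \<odot>\<^bsub>M\<^esub> x"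
      by auto
    then show "\<ominus>\<^bsub>M\<^esub> y \<in> ?N"
      using assms(2) B_closed(3)[of a] by (auto simp: lm_l_minus[symmetric] B_sub)
  next
    show "?N \<noteq> {}"
      using B_closed(1) by blast
  qed (use assms(2) B_sub in \<open>auto simp: lm_smult_closed\<close>)
qed

end

text \<open>If \<open>B\<close> does not annihilate \<open>x\<close>, then \<open>B x\<close> is a
  nonzero submodule, hence all of \<open>M\<close>; so \<open>A M = A B x = 0\<close> when
  \<open>A B\<close> annihilates \<open>M\<close>.\<close>

lemma primitive_rng_ideal_imp_prime:
  assumes "primitive_rng_ideal P R"
  shows "prime_rng_ideal P R"
proof -
  obtain M :: "('a, 'a set) module" where simple: "simple_left_module R M"
    and P: "P = left_annihilator R M"
    using assms by (auto simp: primitive_rng_ideal_def)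
  interpret rng_left_module R M
    using simple by (simp add: simple_left_module_def)
  have "P \<noteq> carrier R"
    using simple by (auto simp: simple_left_module_def P left_annihilator_def)
  moreover have "A \<subseteq> P" if A: "rng_ideal A R" and B: "rng_ideal B R" and AB: "A \<cdot>\<^bsub>R\<^esub> B \<subseteq> P"
    and "\<not> B \<subseteq> P" for A B
  proof
    have sub: "A \<subseteq> carrier R" "B \<subseteq> carrier R"
      using A B by (auto simp: rng_ideal_def additive_subgroup.a_subset dest: additive_subgroup.a_subset)
    obtain b x where b: "b \<in> B" "x \<in> carrier M" "b \<odot>\<^bsub>M\<^esub> x \<noteq> \<zero>\<^bsub>M\<^esub>"
      using \<open>\<not> B \<subseteq> P\<close> sub(2) by (auto simp: P left_annihilator_def)
    let ?N = "(\<lambda>b. b \<odot>\<^bsub>M\<^esub> x) ` B"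
    have "?N \<noteq> {\<zero>\<^bsub>M\<^esub>}"
      using b by auto
    then have N: "?N = carrier M"
      using simple submodule_image_rng_ideal[OF B b(2)] by (auto simp: simple_left_module_def)
    fix a assume a: "a \<in> A"
    have "a \<odot>\<^bsub>M\<^esub> y = \<zero>\<^bsub>M\<^esub>" if "y \<in> carrier M" for y
    proof -
      obtain b' where b': "b' \<in> B" "y = b' \<odot>\<^bsub>M\<^esub> x"
        using N \<open>y \<in> carrier M\<close> by blast
      have "a \<otimes>\<^bsub>R\<^esub> b' \<in> P"
        using ideal_prod.prod[OF a b'(1)] AB by blast
      then have "(a \<otimes>\<^bsub>R\<^esub> b') \<odot>\<^bsub>M\<^esub> x = \<zero>\<^bsub>M\<^esub>"
        using b(2) by (simp add: P left_annihilator_def)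
      then show ?thesis
        using lm_smult_assoc[of a b' x] b' b(2) a sub by auto
    qed
    then show "a \<in> P"
      using a sub by (auto simp: P left_annihilator_def)
  qed
  ultimately show ?thesis
    using left_annihilator_rng_ideal
    by (auto simp: prime_rng_ideal_def proper_rng_ideal_def P)
qed

section \<open>Condition (K) implies that ideals are intersections of primitive ideals\<close>

lemma lpa_rels_in_alg_terms:
  fixes s t :: "(('v, 'e) lpa_gen, 'k::field) alg_term"
  assumes "wf_digraph E" "(s, t) \<in> lpa_rels E"
  shows "s \<in> alg_terms (lpa_gens E) \<and> t \<in> alg_terms (lpa_gens E)"
proof -
  interpret wf_digraph E
    by (fact assms(1))
  have sum: "foldr (\<lambda>e t. Add (Mult (Gen (Edge e)) (Gen (Ghost e))) t) es
      (Zero :: (('v, 'e) lpa_gen, 'k) alg_term) \<in> alg_terms (lpa_gens E)"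
    if "set es \<subseteq> arcs E" for es
    using that by (induction es) (auto simp: lpa_gens_def)
  show ?thesis
    using assms(2)
  proof cases
    case (regular_sum v es)
    then have "set es \<subseteq> arcs E" "Vertex v \<in> lpa_gens E"
      by (auto simp: lpa_gens_def regular_vertex_def)
    then show ?thesis
      using regular_sum sum by simp
  qed (auto simp: lpa_gens_def)
qed

lemma presented_algebra_minus:
  assumes "t \<in> alg_terms X"
  shows "\<ominus>\<^bsub>presented_algebra X Rel\<^esub> alg_class X Rel t = alg_class X Rel (Scale (- 1) t)"
proof -
  interpret rng "presented_algebra X Rel"
    by (rule rng_presented_algebra)
  show ?thesis
    using assms by (intro minus_equality)
      (simp_all add: presented_algebra_simps presented_algebra_zero presented_algebra_carrier
        alg_class_eq_iff alg_cong.add_inverse)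
qed

text \<open>The idempotent multiple of \<open>a\<close> is found in the image of
  \<open>L / I\<close> and lifted to a term \<open>q\<close>, whose class is idempotent modulo
  \<open>I\<close> only.\<close>

lemma condition_K_primitive_rng_ideal:
  fixes E :: "('v, 'e) pre_digraph" and I :: "('v, 'e, 'k::field) lpa set"
  assumes wf: "wf_digraph E" and K: "condition_K E"
    and I: "rng_ideal I (leavitt_path_algebra E)"
    and a: "a \<in> carrier (leavitt_path_algebra E)" "a \<notin> I"
  obtains P where "primitive_rng_ideal P (leavitt_path_algebra E)" "I \<subseteq> P" "a \<notin> P"
proof -
  let ?X = "lpa_gens E" and ?R = "lpa_rels E :: (_, 'k) alg_term rel"
  let ?L = "presented_algebra ?X ?R"
  have L: "leavitt_path_algebra E = ?L"
    by (simp add: leavitt_path_algebra_def)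
  obtain sc :: "'k \<Rightarrow> (('v, 'e) lpa_gen, 'k) free_alg endo" and \<rho>
    where central: "central_scalars sc \<rho>"
      and ev_zero: "\<And>t. t \<in> alg_terms ?X \<Longrightarrow> alg_eval sc \<rho> t = 0 \<longleftrightarrow> alg_class ?X ?R t \<in> I"
      and rels: "\<And>s t. (s, t) \<in> ?R \<Longrightarrow> s \<in> alg_terms ?X \<Longrightarrow> t \<in> alg_terms ?X \<Longrightarrow>
        alg_eval sc \<rho> s = alg_eval sc \<rho> t"
    by (rule quotient_representation[OF I[unfolded L] lpa_right_unit[OF wf]])
      (assumption, (rule that; assumption))
  interpret leavitt_family E sc \<rho>
    using lpa_rels_in_alg_terms[OF wf] rels
    by (intro leavitt_family.intro leavitt_family_axioms.intro wf central) blast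
  obtain t where t: "t \<in> alg_terms ?X" "a = alg_class ?X ?R t"
    using a(1) by (auto simp: L presented_algebra_carrier)
  then have "ev t \<noteq> 0"
    using a(2) ev_zero by simp
  moreover have "ev t \<in> subalg"
    using t(1) by (simp add: subalg_def)
  then obtain n where "ev t \<in> mono_span n"
    using subalg_mono_span by blast
  ultimately have "reducible (ev t)"
    using condition_K_reducible[OF K] by blast
  then obtain r s where rs: "r \<in> alg_terms ?X" "s \<in> alg_terms ?X"
    and "ev r * ev t * ev s \<noteq> 0"
    and "(ev r * ev t * ev s) * (ev r * ev t * ev s) = ev r * ev t * ev s"
    by (auto simp: reducible_def subalg_def)
  moreover define q where "q = Mult (Mult r t) s"
  ultimately have q: "q \<in> alg_terms ?X" "ev q \<noteq> 0" "ev (Add (Mult q q) (Scale (- 1) q)) = 0"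
    using t(1) by (simp_all add: sc_minus_one)
  let ?p = "alg_class ?X ?R q"
  interpret R: rng ?L
    by (rule rng_presented_algebra)
  have "?p \<otimes>\<^bsub>?L\<^esub> ?p \<ominus>\<^bsub>?L\<^esub> ?p \<in> I"
    using q ev_zero[of "Add (Mult q q) (Scale (- 1) q)"]
    by (simp add: R.minus_eq presented_algebra_minus presented_algebra_simps)
  moreover have "?p \<in> carrier ?L" "?p \<notin> I"
    using q ev_zero by (simp_all add: presented_algebra_carrier)
  ultimately obtain P where P: "primitive_rng_ideal P ?L" "I \<subseteq> P" "?p \<notin> P"
    using R.idempotent_primitive_rng_ideal[OF I[unfolded L]] by metis
  have "rng_ideal P ?L"
    using primitive_rng_ideal_imp_prime[OF P(1)]
    by (simp add: prime_rng_ideal_def proper_rng_ideal_def)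
  moreover have "?p = (alg_class ?X ?R r \<otimes>\<^bsub>?L\<^esub> a) \<otimes>\<^bsub>?L\<^esub> alg_class ?X ?R s"
    using rs t by (simp add: q_def presented_algebra_simps)
  ultimately have "a \<notin> P"
    using P(3) rs by (auto simp: presented_algebra_carrier rng_ideal.rng_I_l_closed
        rng_ideal.rng_I_r_closed)
  with P that show thesis
    by (simp add: L)
qed


section \<open>A non-semiprime ideal in the absence of Condition (K)\<close>

text \<open>Used with \<open>z = 1\<close> for the kernel of a representation and with
  \<open>z = eps\<close> for the elements that \<open>eps\<close> annihilates. Commutation with
  \<open>z\<close> gives closure under left multiplication.\<close>

lemma kernel_rng_ideal:
  fixes X :: "'x set" and Rel :: "('x, 'k::field) alg_term rel" and z :: "'a::{ring, monoid_mult}"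
  assumes "central_scalars sc \<rho>"
    and rels: "\<And>s t. (s, t) \<in> Rel \<Longrightarrow> alg_eval sc \<rho> s = alg_eval sc \<rho> t"
    and z: "\<And>a. z * sc a = sc a * z" "\<And>x. z * \<rho> x = \<rho> x * z"
  defines "J \<equiv> {alg_class X Rel t | t. t \<in> alg_terms X \<and> z * alg_eval sc \<rho> t = 0}"
  shows "rng_ideal J (presented_algebra X Rel)"
    and "\<And>t. t \<in> alg_terms X \<Longrightarrow> alg_class X Rel t \<in> J \<longleftrightarrow> z * alg_eval sc \<rho> t = 0"
proof -
  interpret central_scalars sc \<rho>
    by (fact assms(1))
  interpret R: rng "presented_algebra X Rel"
    by (rule rng_presented_algebra)
  have mem: "alg_class X Rel t \<in> J \<longleftrightarrow> z * ev t = 0" if "t \<in> alg_terms X" for t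
    using that ev_cong[OF _ rels] unfolding J_def by (auto simp: alg_class_eq_iff)
  show "\<And>t. t \<in> alg_terms X \<Longrightarrow> alg_class X Rel t \<in> J \<longleftrightarrow> z * ev t = 0"
    by (fact mem)
  have pull: "z * (ev s * x) = ev s * (z * x)" for s x
    using alg_eval_commute[of z sc \<rho> s, OF z] by (metis mult.assoc)
  note simps = presented_algebra_simps presented_algebra_minus presented_algebra_zero
  show "rng_ideal J (presented_algebra X Rel)"
  proof (intro rng_ideal.intro rng_ideal_axioms.intro additive_subgroup.intro subgroup.intro)
    show "rng (presented_algebra X Rel)"
      by (rule R.rng_axioms)
    show "J \<subseteq> carrier (add_monoid (presented_algebra X Rel))"
      by (auto simp: J_def presented_algebra_carrier)
  next
    fix a b assume "a \<in> J" "b \<in> J"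
    then obtain s t where "s \<in> alg_terms X" "t \<in> alg_terms X" "z * ev s = 0" "z * ev t = 0"
      "a = alg_class X Rel s" "b = alg_class X Rel t"
      by (auto simp: J_def)
    then show "a \<otimes>\<^bsub>add_monoid (presented_algebra X Rel)\<^esub> b \<in> J"
      by (simp add: simps mem distrib_left)
  next
    show "\<one>\<^bsub>add_monoid (presented_algebra X Rel)\<^esub> \<in> J"
      by (simp add: simps mem)
  next
    fix a assume "a \<in> J"
    then obtain t where "t \<in> alg_terms X" "z * ev t = 0" "a = alg_class X Rel t"
      by (auto simp: J_def)
    then show "inv\<^bsub>add_monoid (presented_algebra X Rel)\<^esub> a \<in> J"
      unfolding a_inv_def[symmetric] by (simp add: simps mem sc_minus_one)
  next
    fix a x assume "a \<in> J" "x \<in> carrier (presented_algebra X Rel)"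
    then obtain s t where "s \<in> alg_terms X" "t \<in> alg_terms X" "z * ev t = 0"
      "x = alg_class X Rel s" "a = alg_class X Rel t"
      by (auto simp: J_def presented_algebra_carrier)
    note st = this
    show "x \<otimes>\<^bsub>presented_algebra X Rel\<^esub> a \<in> J"
      using st by (simp add: simps mem pull)
    show "a \<otimes>\<^bsub>presented_algebra X Rel\<^esub> x \<in> J"
      using st by (simp add: simps mem mult.assoc[symmetric])
  qed
qed

text \<open>The module is spanned over the dual numbers \<open>K[\<epsilon>]\<close> by the paths that end with their first
  visit to \<open>v\<close>; going once around the unique simple closed path \<open>c\<close> multiplies by
  \<open>-1 + \<epsilon>\<close>, so that \<open>v + c\<close> acts as \<open>\<epsilon>\<close> times \<open>v\<close>.
  A pair \<open>(a, b)\<close> stands for \<open>a + b \<epsilon>\<close>.\<close>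

locale unique_simple_closed_path = wf_digraph E
  for E :: "('v, 'e) pre_digraph" +
  fixes v :: 'v and c :: "'e list"
  assumes closed: "simple_closed_path E v c"
    and unique: "simple_closed_path E v c' \<Longrightarrow> c' = c"
begin

section \<open>Combinatorics of first visits to \<open>v\<close>\<close>

definition start :: "'e list \<Rightarrow> 'v" where
  "start p = (if p = [] then v else tail E (hd p))"

definition first_visits :: "'e list set" where
  "first_visits = {p. awalk (start p) p v \<and> (\<forall>e\<in>set p. tail E e \<noteq> v)}"

text \<open>The empty path doubles as one full turn around \<open>c\<close>, so it inherits the
  first arc of \<open>c\<close>. Thus every basis path has exactly one first arc, as
  \<open>regular_sum\<close> demands.\<close>

definition first_arc :: "'e list \<Rightarrow> 'e" where
  "first_arc p = (if p = [] then hd c else hd p)"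

definition rest :: "'e list \<Rightarrow> 'e list" where
  "rest p = (if p = [] then tl c else tl p)"

text \<open>An arc leaving \<open>v\<close>, put before a first visit, completes the cycle
  \<open>c\<close>, which is identified with the empty path.\<close>

definition extend :: "'e \<Rightarrow> 'e list \<Rightarrow> 'e list" where
  "extend e p = (if tail E e = v then [] else e # p)"

lemma c_Cons: "c = hd c # tl c"
  using closed by (simp add: simple_closed_path_def)

lemma awalk_start: "awalk u p v \<Longrightarrow> start p = u"
  by (cases p) (auto simp: start_def awalk_simps)

lemma c_props: "hd c \<in> arcs E" "tail E (hd c) = v" "awalk (head E (hd c)) (tl c) v"
  "e \<in> set (tl c) \<Longrightarrow> tail E e \<noteq> v"
  using closed by (cases c; auto simp: simple_closed_path_def awalk_Cons_iff)+

text \<open>Uniqueness of \<open>c\<close> enters here: an arc from \<open>v\<close> followed by a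
  first visit is a simple closed path, hence \<open>c\<close>, so \<open>rest\<close> undoes
  \<open>extend\<close> in that case too.\<close>

lemma first_visits_extend:
  assumes "p \<in> first_visits" "e \<in> arcs E" "start p = head E e"
  shows "extend e p \<in> first_visits" "first_arc (extend e p) = e" "rest (extend e p) = p"
    "start (extend e p) = tail E e"
proof -
  have p: "awalk (head E e) p v" "\<forall>e\<in>set p. tail E e \<noteq> v"
    using assms by (auto simp: first_visits_def)
  have c: "c = e # p" if "tail E e = v"
    using that p assms(2) unique[of "e # p"] by (simp add: simple_closed_path_def awalk_simps)
  have "v \<in> verts E"
    using p(1) by (rule awalk_last_in_verts)
  then show "extend e p \<in> first_visits" "first_arc (extend e p) = e" "rest (extend e p) = p"
    "start (extend e p) = tail E e"
    using p c assms
    by (auto simp: extend_def first_visits_def first_arc_def rest_def start_def awalk_simps)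
qed

lemma first_visits_rest:
  assumes "q \<in> first_visits"
  shows "rest q \<in> first_visits" "first_arc q \<in> arcs E" "start (rest q) = head E (first_arc q)"
    "tail E (first_arc q) = start q" "extend (first_arc q) (rest q) = q"
proof -
  have "rest q \<in> first_visits \<and> first_arc q \<in> arcs E \<and> start (rest q) = head E (first_arc q) \<and>
    tail E (first_arc q) = start q \<and> extend (first_arc q) (rest q) = q"
  proof (cases q)
    case Nil
    have "start (tl c) = head E (hd c)"
      using c_props(3) by (rule awalk_start)
    moreover have "start [] = v"
      by (simp add: start_def)
    ultimately show ?thesis
      using Nil c_props by (simp add: rest_def first_arc_def extend_def first_visits_def)
  next
    case (Cons e p)
    then have p: "e \<in> arcs E" "awalk (head E e) p v" "\<forall>e\<in>set q. tail E e \<noteq> v"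
      using assms by (auto simp: first_visits_def awalk_simps)
    then have "start p = head E e"
      using awalk_start by blast
    moreover have "start q = tail E e"
      using Cons by (simp add: start_def)
    ultimately show ?thesis
      using p Cons by (simp add: rest_def first_arc_def extend_def first_visits_def)
  qed
  then show "rest q \<in> first_visits" "first_arc q \<in> arcs E" "start (rest q) = head E (first_arc q)"
    "tail E (first_arc q) = start q" "extend (first_arc q) (rest q) = q"
    by blast+
qed

lemma Nil_first_visits: "[] \<in> first_visits" "start [] = v" "v \<in> verts E"
  using closed by (auto simp: first_visits_def start_def simple_closed_path_def awalk_simps
      dest: awalk_hd_in_verts)

lemma start_eq_base: "q \<in> first_visits \<Longrightarrow> start q = v \<longleftrightarrow> q = []"
  by (cases q) (auto simp: first_visits_def start_def)

text \<open>Multiplication by \<open>-1 + eps\<close> at the empty path: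
  \<open>(a + b eps) (-1 + eps) = -a + (a - b) eps\<close>. The twist is charged to the first arc of
  \<open>c\<close> alone.\<close>

definition turn :: "'e list \<Rightarrow> 'k::field \<times> 'k \<Rightarrow> 'k \<times> 'k" where
  "turn q x = (if q = [] then (- fst x, fst x - snd x) else x)"

text \<open>The inverse factor is \<open>-1 - eps\<close>, because \<open>eps^2 = 0\<close>.\<close>

definition unturn :: "'e list \<Rightarrow> 'k::field \<times> 'k \<Rightarrow> 'k \<times> 'k" where
  "unturn q x = (if q = [] then (- fst x, - fst x - snd x) else x)"

lemma turn_simps [simp]:
  "turn q (x + y) = turn q x + turn q y" "unturn q (x + y) = unturn q x + unturn q y"
  "turn q (unturn q x) = x" "unturn q (turn q x) = x" "turn q 0 = 0" "unturn q 0 = 0"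
  by (auto simp: turn_def unturn_def prod_eq_iff)

text \<open>\<open>f p\<close> is the coefficient of the path \<open>p\<close>. The edge
  \<open>e\<close> sends \<open>p\<close> to \<open>extend e p\<close>, so the new coefficient at
  \<open>q\<close> is read off at \<open>rest q\<close>; the ghost moves coefficients back.\<close>

primrec act :: "('v, 'e) lpa_gen \<Rightarrow> ('e list \<Rightarrow> 'k::field \<times> 'k) endo" where
  "act (Vertex u) = Endo (\<lambda>f p. if p \<in> first_visits \<and> start p = u then f p else 0)"
| "act (Edge e) = Endo (\<lambda>f q. if q \<in> first_visits \<and> first_arc q = e then turn q (f (rest q)) else 0)"
| "act (Ghost e) = Endo (\<lambda>f p. if p \<in> first_visits \<and> start p = head E e \<and> e \<in> arcs E
      then unturn (extend e p) (f (extend e p)) else 0)"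

declare act.simps [simp del]

definition scal :: "'k \<Rightarrow> ('e list \<Rightarrow> 'k::field \<times> 'k) endo" where
  "scal a = Endo (\<lambda>f p. (a * fst (f p), a * snd (f p)))"

definition eps :: "('e list \<Rightarrow> 'k::field \<times> 'k) endo" where
  "eps = Endo (\<lambda>f p. (0, fst (f p)))"

lemma app_act:
  "app (act (Vertex u)) f p = (if p \<in> first_visits \<and> start p = u then f p else 0)"
  "app (act (Edge e)) f p = (if p \<in> first_visits \<and> first_arc p = e then turn p (f (rest p)) else 0)"
  "app (act (Ghost e)) f p = (if p \<in> first_visits \<and> start p = head E e \<and> e \<in> arcs E
      then unturn (extend e p) (f (extend e p)) else 0)"
  "app (scal a) f p = (a * fst (f p), a * snd (f p))"
  "app eps f p = (0, fst (f p))"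
  unfolding act.simps scal_def eps_def
  by (subst Endo_inverse; simp add: fun_eq_iff plus_fun_def prod_eq_iff distrib_left)+

lemma central_act: "central_scalars (scal :: 'k::field \<Rightarrow> _) act"
proof
  fix a b :: 'k and x
  show "scal (a + b) = scal a + scal b" "scal (a * b) = scal a * scal b"
    by (rule endo_eqI; simp add: fun_eq_iff app_act prod_eq_iff distrib_right)+
  show "scal (1 :: 'k) = 1"
    by (rule endo_eqI) (simp add: fun_eq_iff app_act)
  show "scal a * act x = act x * scal a"
    by (cases x; rule endo_eqI)
      (simp_all add: fun_eq_iff app_act turn_def unturn_def right_diff_distrib zero_prod_def)
qed

lemma eps_commute: "eps * scal a = scal a * eps" "eps * act x = act x * eps"
proof -
  show "eps * scal a = scal a * eps"
    by (rule endo_eqI) (simp add: fun_eq_iff app_act)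
  show "eps * act x = act x * eps"
    by (cases x; rule endo_eqI) (simp_all add: fun_eq_iff app_act turn_def unturn_def zero_prod_def)
qed

lemma edge_ghost_act:
  "app (act (Edge e)) (app (act (Ghost e)) f) q = (if q \<in> first_visits \<and> first_arc q = e then f q else 0)"
  using first_visits_rest[of q] by (auto simp: app_act)

text \<open>By \<open>edge_ghost_act\<close>, an edge times its ghost projects onto the paths with
  that first arc. The first arc of a first visit starting at \<open>u\<close> leaves
  \<open>u\<close>, also for the empty path, so these projections add up to the vertex.\<close>

lemma act_rels:
  assumes "(s, t) \<in> (lpa_rels E :: (_, 'k::field) alg_term rel)"
  shows "alg_eval scal act s = alg_eval scal act t"
  using assms
proof cases
  case (regular_sum u es)
  have "app (alg_eval scal act (foldr (\<lambda>e t. Add (Mult (Gen (Edge e)) (Gen (Ghost e))) t) es Zero)) f q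
      = (if q \<in> first_visits \<and> first_arc q \<in> set es then f q else 0)"
    if "distinct es" for f :: "'e list \<Rightarrow> 'k \<times> 'k" and q
    using that
    by (induction es) (auto simp: edge_ghost_act)
  moreover have "first_arc q \<in> out_arcs E u \<longleftrightarrow> start q = u" if "q \<in> first_visits" for q
    using first_visits_rest[OF that] by auto
  ultimately show ?thesis
    using regular_sum by (intro endo_eqI) (auto simp: fun_eq_iff app_act)
qed (rule endo_eqI; auto simp: fun_eq_iff app_act first_visits_extend first_visits_rest)+

sublocale family: leavitt_family E "scal :: 'k::field \<Rightarrow> _" act
  by (intro leavitt_family.intro leavitt_family_axioms.intro wf_digraph_axioms central_act act_rels)

text \<open>No arc of a first visit leaves \<open>v\<close>, so the twist is never met on the
  way.\<close>

lemma path_act: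
  "p \<in> first_visits \<Longrightarrow> app (family.path (start p) p) f p = f []"
proof (induction p)
  case Nil
  then show ?case
    by (simp add: app_act Nil_first_visits)
next
  case (Cons e p)
  have p: "p \<in> first_visits" "start p = head E e"
    using first_visits_rest(1,3)[OF Cons.prems] by (simp_all add: rest_def first_arc_def)
  then show ?case
    using Cons by (simp add: app_act first_arc_def rest_def turn_def)
qed

text \<open>One turn along \<open>c\<close> multiplies the coefficient of the empty path by
  \<open>-1 + eps\<close>; adding the vertex cancels the \<open>-1\<close>.\<close>

lemma base_plus_path: "act (Vertex v) + family.path v c = eps * act (Vertex v)"
proof (rule endo_eqI, rule ext)
  fix f :: "'e list \<Rightarrow> 'a \<times> 'a" and q
  have tl: "tl c \<in> first_visits" "start (tl c) = head E (hd c)"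
    using first_visits_rest(1,3)[OF Nil_first_visits(1)] by (simp_all add: rest_def first_arc_def)
  have "first_arc q = hd c \<longleftrightarrow> q = []" if "q \<in> first_visits"
    using first_visits_rest(4)[OF that] c_props(2) start_eq_base[OF that]
    by (auto simp: first_arc_def)
  then have "app (family.path v c) f q
      = (if q = [] then turn [] (app (family.path (start (tl c)) (tl c)) f (tl c)) else 0)"
    using tl Nil_first_visits(1) by (subst c_Cons) (auto simp: app_act rest_def)
  also have "\<dots> = (if q = [] then turn [] (f []) else 0)"
    by (simp add: path_act[OF tl(1)])
  finally show "app (act (Vertex v) + family.path v c) f q = app (eps * act (Vertex v)) f q"
    using start_eq_base[of q] Nil_first_visits
    by (auto simp: app_act turn_def prod_eq_iff)
qed

lemma eps_base_nonzero: "eps * act (Vertex v) \<noteq> (0 :: ('e list \<Rightarrow> 'k::field \<times> 'k) endo)"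
proof
  assume "eps * act (Vertex v) = (0 :: ('e list \<Rightarrow> 'k \<times> 'k) endo)"
  then have "app (eps * act (Vertex v)) (\<lambda>_. (1, 0)) [] = (0 :: 'k \<times> 'k)"
    by simp
  then show False
    by (simp add: app_act Nil_first_visits zero_prod_def)
qed

lemma eps_eps: "eps * eps = 0"
  by (rule endo_eqI) (simp add: fun_eq_iff app_act zero_prod_def)

text \<open>The kernel of \<open>\<epsilon>\<close> is its range.\<close>

lemma eps_kill_mult:
  assumes x: "x * eps = eps * x" "eps * x = 0" and y: "eps * y = 0"
  shows "x * y = (0 :: ('e list \<Rightarrow> 'k::field \<times> 'k) endo)"
proof (rule endo_eqI)
  fix f
  let ?g = "app y f"
  have "app eps ?g = 0"
    using y app_simps(6)[of eps y f] by simp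
  then have "fst (?g p) = 0" for p
    using app_act(5)[of ?g p] by (simp add: zero_prod_def)
  then have "?g = app eps (\<lambda>p. (snd (?g p), 0))"
    by (auto simp: fun_eq_iff app_act prod_eq_iff)
  then have "app x ?g = app (x * eps) (\<lambda>p. (snd (?g p), 0))"
    by simp
  also have "\<dots> = 0"
    using x by simp
  finally show "app (x * y) f = app 0 f"
    by simp
qed

lemma non_semiprime_ideal:
  obtains I A where "proper_rng_ideal I (leavitt_path_algebra E)"
    "rng_ideal A (leavitt_path_algebra E :: ('k::field, _) module)"
    "A \<cdot>\<^bsub>leavitt_path_algebra E\<^esub> A \<subseteq> I" "\<not> A \<subseteq> I"
proof -
  let ?X = "lpa_gens E" and ?R = "lpa_rels E :: (_, 'k) alg_term rel"
  let ?L = "presented_algebra ?X ?R"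
  let ?ev = "alg_eval (scal :: 'k \<Rightarrow> _) act"
  define J where "J z = {alg_class ?X ?R t | t. t \<in> alg_terms ?X \<and> z * ?ev t = 0}" for z
  have I: "rng_ideal (J 1) ?L"
    and mem_I: "\<And>t. t \<in> alg_terms ?X \<Longrightarrow> alg_class ?X ?R t \<in> J 1 \<longleftrightarrow> 1 * ?ev t = 0"
    unfolding J_def by (rule kernel_rng_ideal[OF central_act act_rels]; simp)+
  have A: "rng_ideal (J eps) ?L"
    and mem_A: "\<And>t. t \<in> alg_terms ?X \<Longrightarrow> alg_class ?X ?R t \<in> J eps \<longleftrightarrow> eps * ?ev t = 0"
    unfolding J_def by (rule kernel_rng_ideal[OF central_act act_rels eps_commute]; simp)+
  have ev_eps: "?ev t * eps = eps * ?ev t" for t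
    by (rule alg_eval_commute[OF eps_commute, symmetric])
  have "x \<in> J 1" if "x \<in> J eps \<cdot>\<^bsub>?L\<^esub> J eps" for x
    using that
  proof induction
    case (prod a b)
    then obtain s t where st: "s \<in> alg_terms ?X" "t \<in> alg_terms ?X" "eps * ?ev s = 0" "eps * ?ev t = 0"
      "a = alg_class ?X ?R s" "b = alg_class ?X ?R t"
      by (auto simp: J_def)
    have "?ev s * ?ev t = 0"
      using st(3,4) by (rule eps_kill_mult[OF ev_eps])
    then show ?case
      using st by (simp add: presented_algebra_simps mem_I)
  next
    case (sum a b)
    then show ?case
      using I by (simp add: rng_ideal_def additive_subgroup.a_closed)
  qed
  then have sub: "J eps \<cdot>\<^bsub>?L\<^esub> J eps \<subseteq> J 1"
    by blast
  have "awalk v c v"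
    using closed by (simp add: simple_closed_path_def)
  then have "family.path v c \<in> (family.subalg :: ('e list \<Rightarrow> 'k \<times> 'k) endo set)"
    by (rule family.subalg_path)
  then obtain t where t: "t \<in> alg_terms ?X" "?ev t = family.path v c"
    by (auto simp: family.subalg_def)
  \<comment> \<open>\<open>v + c\<close> acts as \<open>eps v\<close>, which is nonzero but
    annihilated by \<open>eps\<close>.\<close>
  define s where "s = Add (Gen (Vertex v)) t"
  have s: "s \<in> alg_terms ?X" "?ev s = eps * act (Vertex v)"
    using t Nil_first_visits(3) base_plus_path by (simp_all add: s_def lpa_gens_def)
  then have *: "alg_class ?X ?R s \<in> J eps" "alg_class ?X ?R s \<notin> J 1"
    using eps_base_nonzero by (simp_all add: mem_A mem_I eps_eps mult.assoc[symmetric])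
  have "alg_class ?X ?R s \<in> carrier ?L"
    using s by (simp add: presented_algebra_carrier)
  then have "J 1 \<noteq> carrier ?L" "\<not> J eps \<subseteq> J 1"
    using * by auto
  then show thesis
    using that[of "J 1" "J eps"] I A sub by (simp add: leavitt_path_algebra_def proper_rng_ideal_def)
qed

end

theorem theorem2p5:
  fixes E :: "('v, 'e) pre_digraph"
    and L :: "('k::field, ('v, 'e, 'k) lpa) module"
  assumes "wf_digraph E"
    and "L = leavitt_path_algebra E"
  shows "((\<forall>I. proper_rng_ideal I L \<longrightarrow> I = \<Inter>{P. primitive_rng_ideal P L \<and> I \<subseteq> P})
            \<longleftrightarrow> condition_K E)
       \<and> ((\<forall>I. proper_rng_ideal I L \<longrightarrow> I = \<Inter>{P. prime_rng_ideal P L \<and> I \<subseteq> P})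
            \<longleftrightarrow> condition_K E)"
    (is "(?i \<longleftrightarrow> _) \<and> (?ii \<longleftrightarrow> _)")
proof -
  have i_imp_ii: "?ii" if ?i
  proof (intro allI impI equalityI)
    fix I assume I: "proper_rng_ideal I L"
    have "\<Inter>{P. prime_rng_ideal P L \<and> I \<subseteq> P} \<subseteq> \<Inter>{P. primitive_rng_ideal P L \<and> I \<subseteq> P}"
      using primitive_rng_ideal_imp_prime by blast
    also have "\<dots> = I"
      by (rule that[rule_format, OF I, symmetric])
    finally show "\<Inter>{P. prime_rng_ideal P L \<and> I \<subseteq> P} \<subseteq> I" .
  qed blast
  have ii_imp_K: "condition_K E" if ?ii
  proof (rule ccontr)
    assume "\<not> condition_K E"
    then obtain v c where "simple_closed_path E v c"
      "\<And>c'. simple_closed_path E v c' \<Longrightarrow> c' = c"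
      by (auto simp: condition_K_def)
    then interpret unique_simple_closed_path E v c
      using assms(1) by (intro unique_simple_closed_path.intro unique_simple_closed_path_axioms.intro)
    obtain I A where I: "proper_rng_ideal I L" and A: "rng_ideal A L" "A \<cdot>\<^bsub>L\<^esub> A \<subseteq> I" "\<not> A \<subseteq> I"
      unfolding assms(2) by (rule non_semiprime_ideal)
    have "A \<subseteq> P" if "prime_rng_ideal P L" "I \<subseteq> P" for P
      using that A(1,2) unfolding prime_rng_ideal_def by (meson order_trans)
    then have "A \<subseteq> \<Inter>{P. prime_rng_ideal P L \<and> I \<subseteq> P}"
      by blast
    also have "\<dots> = I"
      by (rule that[rule_format, OF I, symmetric])
    finally show False
      using A(3) by simp
  qed
  have K_imp_i: "?i" if K: "condition_K E"
  proof (intro allI impI equalityI)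
    fix I assume I: "proper_rng_ideal I L"
    then have I_ideal: "rng_ideal I (leavitt_path_algebra E)" and "I \<noteq> carrier L"
      by (simp_all add: proper_rng_ideal_def assms(2))
    then have "I \<subseteq> carrier L"
      by (simp add: assms(2) rng_ideal_def additive_subgroup.a_subset)
    have ex: "\<exists>P. primitive_rng_ideal P L \<and> I \<subseteq> P \<and> a \<notin> P" if "a \<in> carrier L" "a \<notin> I" for a
      using condition_K_primitive_rng_ideal[OF assms(1) K I_ideal] that unfolding assms(2) by metis
    show "\<Inter>{P. primitive_rng_ideal P L \<and> I \<subseteq> P} \<subseteq> I"
    proof
      fix a assume a: "a \<in> \<Inter>{P. primitive_rng_ideal P L \<and> I \<subseteq> P}"
      \<comment> \<open>An empty family would have the whole type as its intersection, so some
        primitive ideal above \<open>I\<close> is needed to place \<open>a\<close> in the carrier.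
        It exists because \<open>I\<close> is proper.\<close>
      obtain P where "primitive_rng_ideal P L" "I \<subseteq> P"
        using ex \<open>I \<noteq> carrier L\<close> \<open>I \<subseteq> carrier L\<close> by blast
      then have "a \<in> carrier L"
        using a by (auto simp: primitive_rng_ideal_def left_annihilator_def)
      then show "a \<in> I"
        using a ex by blast
    qed
  qed blast
  show ?thesis
    using i_imp_ii ii_imp_K K_imp_i by blast
qed

end
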